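(* In $\mathsf P$, the axiom $\mathsf{STP}_2$ is equivalent to $$(\forall^{\mathrm{st}}\Psi^{2\to1^*})(\exists^{\mathrm{st}}W^{2^*})(\forall Y^2\le_21)(\exists Z^2\in W)(\forall f\in\Psi(Z))(Z(f)=_0Y(f)).$$
   Context: $\mathsf P=\mathsf{E\text{-}PA}^{\omega*}+\mathcal T^*_{\mathrm{st}}+\mathsf{IA}^{\mathrm{st}}+\mathsf I+\mathsf{HAC}_{\mathrm{int}}$ in the language of Peano arithmetic in all finite types with finite-sequence types $\rho^*$ and predicates $\mathrm{st}$ (internal = st-free); $\mathcal T^*_{\mathrm{st}}$: $\mathrm{st}(x)\wedge x=y\to\mathrm{st}(y)$, $\mathrm{st}(t)$ for closed terms $t$, $\mathrm{st}(f)\wedge\mathrm{st}(x)\to\mathrm{st}(f(x))$; $\mathsf{IA}^{\mathrm{st}}$: external induction over standard numbers for all formulas; $\mathsf I$: for internal $\varphi$, $(\forall^{\mathrm{st}}x^{\sigma^*})(\exists y)(\forall z\in x)\varphi(z,y)\to(\exists y)(\forall^{\mathrm{st}}x^\sigma)\varphi(x,y)$; $\mathsf{HAC}_{\mathrm{int}}$: for internal $\varphi$, $(\forall^{\mathrm{st}}x^\rho)(\exists^{\mathrm{st}}y^\tau)\varphi(x,y)\to(\exists^{\mathrm{st}}F^{\rho\to\tau^*})(\forall^{\mathrm{st}}x)(\exists y\in F(x))\varphi(x,y)$. $\mathsf{STP}_2$: $(\forall Y^2\le_21)(\exists^{\mathrm{st}}Z^2\le_21)(\forall^{\mathrm{st}}g^1)(Z(g)=_0Y(g))$,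 where $Y\le_21$ means $Y(f)\le1$ for all $f^1$. $Z\in W$ for $W$ of type $2^*$ means $Z=W(i)$ for some $i<|W|$. *)

theory Defs
  imports Main
begin

section \<open>Finite types with finite-sequence types, and terms\<close>

datatype ty =
    N
  | Fn ty ty  (infixr \<open>\<^bold>\<Rightarrow>\<close> 70)
  | Sq ty

abbreviation type1 :: ty where "type1 \<equiv> N \<^bold>\<Rightarrow> N"
abbreviation type2 :: ty where "type2 \<equiv> type1 \<^bold>\<Rightarrow> N"

text \<open>Each variable carries its type, so typing needs no context.\<close>

type_synonym var = "string \<times> ty"

datatype cn =
    Zero
  | Succ
  | Pi ty ty
  | Sig ty ty ty
  | Rec ty
  | Empty ty
  | Cns ty
  | LRec ty ty

fun cty :: "cn \<Rightarrow> ty" where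
  "cty Zero = N"
| "cty Succ = N \<^bold>\<Rightarrow> N"
| "cty (Pi \<sigma> \<tau>) = \<sigma> \<^bold>\<Rightarrow> \<tau> \<^bold>\<Rightarrow> \<sigma>"
| "cty (Sig \<rho> \<sigma> \<tau>) = (\<rho> \<^bold>\<Rightarrow> \<sigma> \<^bold>\<Rightarrow> \<tau>) \<^bold>\<Rightarrow> (\<rho> \<^bold>\<Rightarrow> \<sigma>) \<^bold>\<Rightarrow> \<rho> \<^bold>\<Rightarrow> \<tau>"
| "cty (Rec \<rho>) = \<rho> \<^bold>\<Rightarrow> (\<rho> \<^bold>\<Rightarrow> N \<^bold>\<Rightarrow> \<rho>) \<^bold>\<Rightarrow> N \<^bold>\<Rightarrow> \<rho>"
| "cty (Empty \<sigma>) = Sq \<sigma>"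
| "cty (Cns \<sigma>) = \<sigma> \<^bold>\<Rightarrow> Sq \<sigma> \<^bold>\<Rightarrow> Sq \<sigma>"
| "cty (LRec \<sigma> \<rho>) = \<rho> \<^bold>\<Rightarrow> (\<rho> \<^bold>\<Rightarrow> \<sigma> \<^bold>\<Rightarrow> \<rho>) \<^bold>\<Rightarrow> Sq \<sigma> \<^bold>\<Rightarrow> \<rho>"

datatype tm =
    Var var
  | Con cn
  | App tm tm  (infixl \<open>\<bullet>\<close> 75)

fun tyof :: "tm \<Rightarrow> ty option" where
  "tyof (Var v) = Some (snd v)"
| "tyof (Con c) = Some (cty c)"
| "tyof (t \<bullet> u) =
     (case tyof t of
        Some (\<sigma> \<^bold>\<Rightarrow> \<tau>) \<Rightarrow> if tyof u = Some \<sigma> then Some \<tau> else None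
      | _ \<Rightarrow> None)"

fun fv_tm :: "tm \<Rightarrow> var set" where
  "fv_tm (Var v) = {v}"
| "fv_tm (Con c) = {}"
| "fv_tm (t \<bullet> u) = fv_tm t \<union> fv_tm u"

fun subst_tm :: "var \<Rightarrow> tm \<Rightarrow> tm \<Rightarrow> tm" where
  "subst_tm x s (Var v) = (if v = x then s else Var v)"
| "subst_tm x s (Con c) = Con c"
| "subst_tm x s (t \<bullet> u) = subst_tm x s t \<bullet> subst_tm x s u"


section \<open>Formulas\<close>

text \<open>Equality is primitive at every type. The logic is classical, so the other
  connectives and the existential quantifier are abbreviations.\<close>

datatype fm =
    Eq tm tm  (infix \<open>\<^bold>=\<close> 60)
  | St tm
  | Bot  (\<open>\<^bold>\<bottom>\<close>)
  | Imp fm fm  (infixr \<open>\<^bold>\<longrightarrow>\<close> 35)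
  | Forall var fm  (\<open>(\<open>indent=3 notation=\<open>binder bold all\<close>\<close>\<^bold>\<forall>_./ _)\<close> [100, 30] 30)

abbreviation Neg :: "fm \<Rightarrow> fm"  (\<open>\<^bold>\<not> _\<close> [50] 50) where
  "\<^bold>\<not> \<phi> \<equiv> \<phi> \<^bold>\<longrightarrow> \<^bold>\<bottom>"
abbreviation Conj :: "fm \<Rightarrow> fm \<Rightarrow> fm"  (infixr \<open>\<^bold>\<and>\<close> 45) where
  "\<phi> \<^bold>\<and> \<psi> \<equiv> \<^bold>\<not> (\<phi> \<^bold>\<longrightarrow> \<^bold>\<not> \<psi>)"
abbreviation Disj :: "fm \<Rightarrow> fm \<Rightarrow> fm"  (infixr \<open>\<^bold>\<or>\<close> 40) where
  "\<phi> \<^bold>\<or> \<psi> \<equiv> \<^bold>\<not> \<phi> \<^bold>\<longrightarrow> \<psi>"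
abbreviation Iff :: "fm \<Rightarrow> fm \<Rightarrow> fm"  (infix \<open>\<^bold>\<longleftrightarrow>\<close> 33) where
  "\<phi> \<^bold>\<longleftrightarrow> \<psi> \<equiv> (\<phi> \<^bold>\<longrightarrow> \<psi>) \<^bold>\<and> (\<psi> \<^bold>\<longrightarrow> \<phi>)"
abbreviation Exists :: "var \<Rightarrow> fm \<Rightarrow> fm"
    (\<open>(\<open>indent=3 notation=\<open>binder bold ex\<close>\<close>\<^bold>\<exists>_./ _)\<close> [100, 30] 30) where
  "\<^bold>\<exists>x. \<phi> \<equiv> \<^bold>\<not> (\<^bold>\<forall>x. \<^bold>\<not> \<phi>)"
abbreviation ForallSt :: "var \<Rightarrow> fm \<Rightarrow> fm"
    (\<open>(\<open>indent=3 notation=\<open>binder bold all st\<close>\<close>\<^bold>\<forall>\<^sup>s\<^sup>t_./ _)\<close> [100, 30] 30) where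
  "\<^bold>\<forall>\<^sup>s\<^sup>tx. \<phi> \<equiv> \<^bold>\<forall>x. (St (Var x) \<^bold>\<longrightarrow> \<phi>)"
abbreviation ExistsSt :: "var \<Rightarrow> fm \<Rightarrow> fm"
    (\<open>(\<open>indent=3 notation=\<open>binder bold ex st\<close>\<close>\<^bold>\<exists>\<^sup>s\<^sup>t_./ _)\<close> [100, 30] 30) where
  "\<^bold>\<exists>\<^sup>s\<^sup>tx. \<phi> \<equiv> \<^bold>\<exists>x. (St (Var x) \<^bold>\<and> \<phi>)"

fun wff :: "fm \<Rightarrow> bool" where
  "wff (t \<^bold>= u) \<longleftrightarrow> tyof t \<noteq> None \<and> tyof t = tyof u"
| "wff (St t) \<longleftrightarrow> tyof t \<noteq> None"
| "wff \<^bold>\<bottom> \<longleftrightarrow> True"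
| "wff (\<phi> \<^bold>\<longrightarrow> \<psi>) \<longleftrightarrow> wff \<phi> \<and> wff \<psi>"
| "wff (\<^bold>\<forall>x. \<phi>) \<longleftrightarrow> wff \<phi>"

fun internal :: "fm \<Rightarrow> bool" where
  "internal (t \<^bold>= u) \<longleftrightarrow> True"
| "internal (St t) \<longleftrightarrow> False"
| "internal \<^bold>\<bottom> \<longleftrightarrow> True"
| "internal (\<phi> \<^bold>\<longrightarrow> \<psi>) \<longleftrightarrow> internal \<phi> \<and> internal \<psi>"
| "internal (\<^bold>\<forall>x. \<phi>) \<longleftrightarrow> internal \<phi>"

fun fv :: "fm \<Rightarrow> var set" where
  "fv (t \<^bold>= u) = fv_tm t \<union> fv_tm u"
| "fv (St t) = fv_tm t"
| "fv \<^bold>\<bottom> = {}"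
| "fv (\<phi> \<^bold>\<longrightarrow> \<psi>) = fv \<phi> \<union> fv \<psi>"
| "fv (\<^bold>\<forall>x. \<phi>) = fv \<phi> - {x}"

text \<open>Substitution does not rename bound variables; it is only used under the
  proviso \<open>freefor\<close>, which rules out capture.\<close>

fun subst :: "var \<Rightarrow> tm \<Rightarrow> fm \<Rightarrow> fm" where
  "subst x s (t \<^bold>= u) = (subst_tm x s t \<^bold>= subst_tm x s u)"
| "subst x s (St t) = St (subst_tm x s t)"
| "subst x s \<^bold>\<bottom> = \<^bold>\<bottom>"
| "subst x s (\<phi> \<^bold>\<longrightarrow> \<psi>) = (subst x s \<phi> \<^bold>\<longrightarrow> subst x s \<psi>)"
| "subst x s (\<^bold>\<forall>y. \<phi>) = (if x = y then \<^bold>\<forall>y. \<phi> else \<^bold>\<forall>y. subst x s \<phi>)"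

fun freefor :: "tm \<Rightarrow> var \<Rightarrow> fm \<Rightarrow> bool" where
  "freefor s x (t \<^bold>= u) \<longleftrightarrow> True"
| "freefor s x (St t) \<longleftrightarrow> True"
| "freefor s x \<^bold>\<bottom> \<longleftrightarrow> True"
| "freefor s x (\<phi> \<^bold>\<longrightarrow> \<psi>) \<longleftrightarrow> freefor s x \<phi> \<and> freefor s x \<psi>"
| "freefor s x (\<^bold>\<forall>y. \<phi>) \<longleftrightarrow>
     x \<notin> fv (\<^bold>\<forall>y. \<phi>) \<or> (y \<notin> fv_tm s \<and> freefor s x \<phi>)"


section \<open>Provability\<close>

text \<open>Many-sorted classical natural deduction. The hypotheses in \<open>T\<close> are axioms:
  their free variables are understood universally, so they do not restrict \<open>allI\<close>.\<close>

inductive deriv :: "fm set \<Rightarrow> fm set \<Rightarrow> fm \<Rightarrow> bool"  (\<open>_; _ \<turnstile> _\<close> [50, 50, 30] 30)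
  for T :: "fm set" where
  ax: "\<phi> \<in> T \<Longrightarrow> wff \<phi> \<Longrightarrow> T; H \<turnstile> \<phi>"
| hyp: "\<phi> \<in> H \<Longrightarrow> wff \<phi> \<Longrightarrow> T; H \<turnstile> \<phi>"
| impI: "T; insert \<phi> H \<turnstile> \<psi> \<Longrightarrow> wff \<phi> \<Longrightarrow> T; H \<turnstile> \<phi> \<^bold>\<longrightarrow> \<psi>"
| impE: "T; H \<turnstile> \<phi> \<^bold>\<longrightarrow> \<psi> \<Longrightarrow> T; H \<turnstile> \<phi> \<Longrightarrow> T; H \<turnstile> \<psi>"
| raa: "T; insert (\<^bold>\<not> \<phi>) H \<turnstile> \<^bold>\<bottom> \<Longrightarrow> wff \<phi> \<Longrightarrow> T; H \<turnstile> \<phi>"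
| allI: "T; H \<turnstile> \<phi> \<Longrightarrow> \<forall>\<psi>\<in>H. x \<notin> fv \<psi> \<Longrightarrow> T; H \<turnstile> \<^bold>\<forall>x. \<phi>"
| allE: "T; H \<turnstile> \<^bold>\<forall>x. \<phi> \<Longrightarrow> tyof s = Some (snd x) \<Longrightarrow> freefor s x \<phi> \<Longrightarrow>
         T; H \<turnstile> subst x s \<phi>"


section \<open>Defined terms and relations\<close>

abbreviation zero :: tm where "zero \<equiv> Con Zero"
abbreviation suc :: "tm \<Rightarrow> tm" where "suc t \<equiv> Con Succ \<bullet> t"

text \<open>\<open>comp_tm \<alpha> \<beta> \<gamma> g f\<close> is the composition of \<open>g : \<beta> \<^bold>\<Rightarrow> \<gamma>\<close> with
  \<open>f : \<alpha> \<^bold>\<Rightarrow> \<beta>\<close>.\<close>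

definition comp_tm :: "ty \<Rightarrow> ty \<Rightarrow> ty \<Rightarrow> tm \<Rightarrow> tm \<Rightarrow> tm" where
  "comp_tm \<alpha> \<beta> \<gamma> g f = Con (Sig \<alpha> \<beta> \<gamma>) \<bullet> (Con (Pi (\<beta> \<^bold>\<Rightarrow> \<gamma>) \<alpha>) \<bullet> g) \<bullet> f"

definition id_tm :: "ty \<Rightarrow> tm" where
  "id_tm \<alpha> = Con (Sig \<alpha> (\<alpha> \<^bold>\<Rightarrow> \<alpha>) \<alpha>) \<bullet> Con (Pi \<alpha> (\<alpha> \<^bold>\<Rightarrow> \<alpha>)) \<bullet> Con (Pi \<alpha> \<alpha>)"

text \<open>Predecessor, by recursion with step \<open>\<lambda>r n. n\<close>; truncated subtraction, by
  recursion on the second argument with step \<open>\<lambda>r n. pred r\<close>.\<close>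

definition pred_tm :: tm where
  "pred_tm = Con (Rec N) \<bullet> zero \<bullet> (Con (Pi (N \<^bold>\<Rightarrow> N) N) \<bullet> id_tm N)"

definition monus :: "tm \<Rightarrow> tm \<Rightarrow> tm" where
  "monus t u = Con (Rec N) \<bullet> t \<bullet> comp_tm N N (N \<^bold>\<Rightarrow> N) (Con (Pi N N)) pred_tm \<bullet> u"

definition le :: "tm \<Rightarrow> tm \<Rightarrow> fm"  (infix \<open>\<^bold>\<le>\<close> 60) where
  "t \<^bold>\<le> u = (monus t u \<^bold>= zero)"

definition lt :: "tm \<Rightarrow> tm \<Rightarrow> fm"  (infix \<open>\<^bold><\<close> 60) where
  "t \<^bold>< u = (suc t \<^bold>\<le> u)"

fun default_tm :: "ty \<Rightarrow> tm" where
  "default_tm N = zero"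
| "default_tm (\<sigma> \<^bold>\<Rightarrow> \<tau>) = Con (Pi \<tau> \<sigma>) \<bullet> default_tm \<tau>"
| "default_tm (Sq \<sigma>) = Con (Empty \<sigma>)"

text \<open>Length, by list recursion with step \<open>\<lambda>r a. suc r\<close>.\<close>

definition len_tm :: "ty \<Rightarrow> tm" where
  "len_tm \<sigma> = Con (LRec \<sigma> N) \<bullet> zero \<bullet> comp_tm N N (\<sigma> \<^bold>\<Rightarrow> N) (Con (Pi N \<sigma>)) (Con Succ)"

text \<open>Projection \<open>s, i \<mapsto> s(i)\<close>, by list recursion at type \<open>N \<^bold>\<Rightarrow> \<sigma>\<close>: the
  empty sequence gives the constant default function, and the step is
  \<open>\<lambda>r a. Rec a (\<lambda>_ j. r j)\<close>, that is, \<open>\<lambda>r. Sig Rec (Pi (Pi r))\<close>. So the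
  sequence with head \<open>a\<close> and tail \<open>x\<close> has \<open>a\<close> at place \<open>0\<close> and \<open>x(i)\<close> at place
  \<open>i + 1\<close>, and the default of type \<open>\<sigma>\<close> appears beyond its length.\<close>

definition nth_tm :: "ty \<Rightarrow> tm" where
  "nth_tm \<sigma> =
     (let \<rho> = N \<^bold>\<Rightarrow> \<sigma>; \<kappa> = \<sigma> \<^bold>\<Rightarrow> N \<^bold>\<Rightarrow> \<sigma> in
      Con (LRec \<sigma> \<rho>) \<bullet> (Con (Pi \<sigma> N) \<bullet> default_tm \<sigma>) \<bullet>
        comp_tm \<rho> (\<sigma> \<^bold>\<Rightarrow> \<kappa>) \<kappa>
          (Con (Sig \<sigma> \<kappa> \<rho>) \<bullet> Con (Rec \<sigma>))
          (comp_tm \<rho> \<kappa> (\<sigma> \<^bold>\<Rightarrow> \<kappa>) (Con (Pi \<kappa> \<sigma>)) (Con (Pi \<rho> \<sigma>))))"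

text \<open>\<open>mem \<sigma> i t s\<close> expresses \<open>t \<in> s\<close> for \<open>s\<close> of type \<open>Sq \<sigma>\<close>; the bound variable
  \<open>i\<close> is to be chosen of type \<open>N\<close> and not free in \<open>t\<close>, \<open>s\<close>.\<close>

definition mem :: "ty \<Rightarrow> var \<Rightarrow> tm \<Rightarrow> tm \<Rightarrow> fm" where
  "mem \<sigma> i t s = (\<^bold>\<exists>i. (Var i \<^bold>< len_tm \<sigma> \<bullet> s \<^bold>\<and> t \<^bold>= nth_tm \<sigma> \<bullet> s \<bullet> Var i))"

lemma tyof_comp_tm [simp]:
  "tyof g = Some (\<beta> \<^bold>\<Rightarrow> \<gamma>) \<Longrightarrow> tyof f = Some (\<alpha> \<^bold>\<Rightarrow> \<beta>) \<Longrightarrow>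
   tyof (comp_tm \<alpha> \<beta> \<gamma> g f) = Some (\<alpha> \<^bold>\<Rightarrow> \<gamma>)"
  by (simp add: comp_tm_def)

lemma tyof_id_tm [simp]: "tyof (id_tm \<alpha>) = Some (\<alpha> \<^bold>\<Rightarrow> \<alpha>)"
  by (simp add: id_tm_def)

lemma tyof_pred_tm [simp]: "tyof pred_tm = Some (N \<^bold>\<Rightarrow> N)"
  by (simp add: pred_tm_def)

lemma tyof_monus [simp]:
  "tyof t = Some N \<Longrightarrow> tyof u = Some N \<Longrightarrow> tyof (monus t u) = Some N"
  by (simp add: monus_def)

lemma tyof_default_tm [simp]: "tyof (default_tm \<sigma>) = Some \<sigma>"
  by (induction \<sigma>) simp_all

lemma tyof_len_tm [simp]: "tyof (len_tm \<sigma>) = Some (Sq \<sigma> \<^bold>\<Rightarrow> N)"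
  by (simp add: len_tm_def)

lemma tyof_nth_tm [simp]: "tyof (nth_tm \<sigma>) = Some (Sq \<sigma> \<^bold>\<Rightarrow> N \<^bold>\<Rightarrow> \<sigma>)"
  by (simp add: nth_tm_def Let_def)

lemma wff_mem [simp]:
  "snd i = N \<Longrightarrow> tyof t = Some \<sigma> \<Longrightarrow> tyof s = Some (Sq \<sigma>) \<Longrightarrow> wff (mem \<sigma> i t s)"
  by (simp add: mem_def lt_def le_def)


section \<open>The axioms\<close>

text \<open>Peano arithmetic in all finite types with sequence types: equality, successor
  and induction for internal formulas, the defining equations of the constants,
  extensionality, and the sequence axiom \<open>seq\<close>.\<close>

inductive_set EPA :: "fm set" where
  refl: "tyof t = Some \<sigma> \<Longrightarrow> t \<^bold>= t \<in> EPA"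
| leibniz: "internal \<phi> \<Longrightarrow> wff \<phi> \<Longrightarrow> tyof t = Some (snd x) \<Longrightarrow> tyof u = Some (snd x) \<Longrightarrow>
    freefor t x \<phi> \<Longrightarrow> freefor u x \<phi> \<Longrightarrow>
    (t \<^bold>= u \<^bold>\<longrightarrow> subst x t \<phi> \<^bold>\<longrightarrow> subst x u \<phi>) \<in> EPA"
| suc_nonzero: "tyof t = Some N \<Longrightarrow> (\<^bold>\<not> suc t \<^bold>= zero) \<in> EPA"
| suc_inj: "tyof t = Some N \<Longrightarrow> tyof u = Some N \<Longrightarrow> (suc t \<^bold>= suc u \<^bold>\<longrightarrow> t \<^bold>= u) \<in> EPA"
| ind: "internal \<phi> \<Longrightarrow> wff \<phi> \<Longrightarrow> snd n = N \<Longrightarrow> freefor (suc (Var n)) n \<phi> \<Longrightarrow>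
    (subst n zero \<phi> \<^bold>\<and> (\<^bold>\<forall>n. (\<phi> \<^bold>\<longrightarrow> subst n (suc (Var n)) \<phi>)) \<^bold>\<longrightarrow> (\<^bold>\<forall>n. \<phi>)) \<in> EPA"
| Pi: "tyof t = Some \<sigma> \<Longrightarrow> tyof u = Some \<tau> \<Longrightarrow> Con (Pi \<sigma> \<tau>) \<bullet> t \<bullet> u \<^bold>= t \<in> EPA"
| Sig: "tyof t = Some (\<rho> \<^bold>\<Rightarrow> \<sigma> \<^bold>\<Rightarrow> \<tau>) \<Longrightarrow> tyof u = Some (\<rho> \<^bold>\<Rightarrow> \<sigma>) \<Longrightarrow> tyof v = Some \<rho> \<Longrightarrow>
    Con (Sig \<rho> \<sigma> \<tau>) \<bullet> t \<bullet> u \<bullet> v \<^bold>= t \<bullet> v \<bullet> (u \<bullet> v) \<in> EPA"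
| Rec_zero: "tyof y = Some \<rho> \<Longrightarrow> tyof z = Some (\<rho> \<^bold>\<Rightarrow> N \<^bold>\<Rightarrow> \<rho>) \<Longrightarrow>
    Con (Rec \<rho>) \<bullet> y \<bullet> z \<bullet> zero \<^bold>= y \<in> EPA"
| Rec_suc: "tyof y = Some \<rho> \<Longrightarrow> tyof z = Some (\<rho> \<^bold>\<Rightarrow> N \<^bold>\<Rightarrow> \<rho>) \<Longrightarrow> tyof t = Some N \<Longrightarrow>
    Con (Rec \<rho>) \<bullet> y \<bullet> z \<bullet> suc t \<^bold>= z \<bullet> (Con (Rec \<rho>) \<bullet> y \<bullet> z \<bullet> t) \<bullet> t \<in> EPA"
| LRec_empty: "tyof y = Some \<rho> \<Longrightarrow> tyof z = Some (\<rho> \<^bold>\<Rightarrow> \<sigma> \<^bold>\<Rightarrow> \<rho>) \<Longrightarrow>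
    Con (LRec \<sigma> \<rho>) \<bullet> y \<bullet> z \<bullet> Con (Empty \<sigma>) \<^bold>= y \<in> EPA"
| LRec_cns: "tyof y = Some \<rho> \<Longrightarrow> tyof z = Some (\<rho> \<^bold>\<Rightarrow> \<sigma> \<^bold>\<Rightarrow> \<rho>) \<Longrightarrow>
    tyof a = Some \<sigma> \<Longrightarrow> tyof s = Some (Sq \<sigma>) \<Longrightarrow>
    Con (LRec \<sigma> \<rho>) \<bullet> y \<bullet> z \<bullet> (Con (Cns \<sigma>) \<bullet> a \<bullet> s) \<^bold>=
      z \<bullet> (Con (LRec \<sigma> \<rho>) \<bullet> y \<bullet> z \<bullet> s) \<bullet> a \<in> EPA"
| seq: "tyof t = Some (Sq \<sigma>) \<Longrightarrow> snd a = \<sigma> \<Longrightarrow> snd s = Sq \<sigma> \<Longrightarrow> a \<notin> fv_tm t \<Longrightarrow> s \<notin> fv_tm t \<Longrightarrow>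
    (t \<^bold>= Con (Empty \<sigma>) \<^bold>\<or> (\<^bold>\<exists>a. \<^bold>\<exists>s. t \<^bold>= Con (Cns \<sigma>) \<bullet> Var a \<bullet> Var s)) \<in> EPA"
| ext: "tyof f = Some (\<sigma> \<^bold>\<Rightarrow> \<tau>) \<Longrightarrow> tyof g = Some (\<sigma> \<^bold>\<Rightarrow> \<tau>) \<Longrightarrow> snd x = \<sigma> \<Longrightarrow>
    x \<notin> fv_tm f \<Longrightarrow> x \<notin> fv_tm g \<Longrightarrow>
    ((\<^bold>\<forall>x. f \<bullet> Var x \<^bold>= g \<bullet> Var x) \<^bold>\<longrightarrow> f \<^bold>= g) \<in> EPA"

inductive_set Tst :: "fm set" where
  eq: "tyof t = Some \<sigma> \<Longrightarrow> tyof u = Some \<sigma> \<Longrightarrow> (St t \<^bold>\<and> t \<^bold>= u \<^bold>\<longrightarrow> St u) \<in> Tst"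
| closed: "tyof t = Some \<sigma> \<Longrightarrow> fv_tm t = {} \<Longrightarrow> St t \<in> Tst"
| app: "tyof f = Some (\<sigma> \<^bold>\<Rightarrow> \<tau>) \<Longrightarrow> tyof t = Some \<sigma> \<Longrightarrow> (St f \<^bold>\<and> St t \<^bold>\<longrightarrow> St (f \<bullet> t)) \<in> Tst"

inductive_set IAst :: "fm set" where
  "wff \<phi> \<Longrightarrow> snd n = N \<Longrightarrow> freefor (suc (Var n)) n \<phi> \<Longrightarrow>
   (subst n zero \<phi> \<^bold>\<and> (\<^bold>\<forall>\<^sup>s\<^sup>tn. (\<phi> \<^bold>\<longrightarrow> subst n (suc (Var n)) \<phi>)) \<^bold>\<longrightarrow> (\<^bold>\<forall>\<^sup>s\<^sup>tn. \<phi>)) \<in> IAst"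

text \<open>In the two schemes below \<open>\<phi>\<close> may contain further free variables as
  parameters. In \<open>Ideal\<close> the variable \<open>z\<close> also serves as the quantified variable of
  the conclusion.\<close>

inductive_set Ideal :: "fm set" where
  "internal \<phi> \<Longrightarrow> wff \<phi> \<Longrightarrow> snd z = \<sigma> \<Longrightarrow> snd x = Sq \<sigma> \<Longrightarrow> snd i = N \<Longrightarrow>
   distinct [x, y, z] \<Longrightarrow> i \<noteq> z \<Longrightarrow> x \<notin> fv \<phi> \<Longrightarrow>
   ((\<^bold>\<forall>\<^sup>s\<^sup>tx. \<^bold>\<exists>y. \<^bold>\<forall>z. (mem \<sigma> i (Var z) (Var x) \<^bold>\<longrightarrow> \<phi>)) \<^bold>\<longrightarrow> (\<^bold>\<exists>y. \<^bold>\<forall>\<^sup>s\<^sup>tz. \<phi>)) \<in> Ideal"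

inductive_set HACint :: "fm set" where
  "internal \<phi> \<Longrightarrow> wff \<phi> \<Longrightarrow> snd x = \<rho> \<Longrightarrow> snd y = \<tau> \<Longrightarrow> snd F = \<rho> \<^bold>\<Rightarrow> Sq \<tau> \<Longrightarrow> snd i = N \<Longrightarrow>
   distinct [F, x, y] \<Longrightarrow> i \<noteq> x \<Longrightarrow> i \<noteq> y \<Longrightarrow> F \<notin> fv \<phi> \<Longrightarrow>
   ((\<^bold>\<forall>\<^sup>s\<^sup>tx. \<^bold>\<exists>\<^sup>s\<^sup>ty. \<phi>) \<^bold>\<longrightarrow>
   (\<^bold>\<exists>\<^sup>s\<^sup>tF. \<^bold>\<forall>\<^sup>s\<^sup>tx. \<^bold>\<exists>y. (mem \<tau> i (Var y) (Var F \<bullet> Var x) \<^bold>\<and> \<phi>))) \<in> HACint"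

definition P_sys :: "fm set" where
  "P_sys = EPA \<union> Tst \<union> IAst \<union> Ideal \<union> HACint"


section \<open>The standard part principle and its normal form\<close>

text \<open>Only applied to terms in which the bound variable \<open>f\<close> does not occur.\<close>

definition le2_one :: "tm \<Rightarrow> fm"  (\<open>_ \<^bold>\<le>\<^sub>2 \<^bold>1\<close> [61] 60) where
  "t \<^bold>\<le>\<^sub>2 \<^bold>1 = (let f = (''f'', type1) in \<^bold>\<forall>f. t \<bullet> Var f \<^bold>\<le> suc zero)"

definition STP2 :: fm where
  "STP2 =
     (let Y = (''Y'', type2); Z = (''Z'', type2); g = (''g'', type1) in
      \<^bold>\<forall>Y. (Var Y \<^bold>\<le>\<^sub>2 \<^bold>1 \<^bold>\<longrightarrow>
        (\<^bold>\<exists>\<^sup>s\<^sup>tZ. (Var Z \<^bold>\<le>\<^sub>2 \<^bold>1 \<^bold>\<and> (\<^bold>\<forall>\<^sup>s\<^sup>tg. Var Z \<bullet> Var g \<^bold>= Var Y \<bullet> Var g)))))"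

definition STP2_normal_form :: fm where
  "STP2_normal_form =
     (let \<Psi> = (''Psi'', type2 \<^bold>\<Rightarrow> Sq type1); W = (''W'', Sq type2);
          Y = (''Y'', type2); Z = (''Z'', type2); f = (''f'', type1); i = (''i'', N) in
      \<^bold>\<forall>\<^sup>s\<^sup>t\<Psi>. \<^bold>\<exists>\<^sup>s\<^sup>tW. \<^bold>\<forall>Y. (Var Y \<^bold>\<le>\<^sub>2 \<^bold>1 \<^bold>\<longrightarrow>
        (\<^bold>\<exists>Z. (mem type2 i (Var Z) (Var W) \<^bold>\<and>
          (\<^bold>\<forall>f. (mem type1 i (Var f) (Var \<Psi> \<bullet> Var Z) \<^bold>\<longrightarrow> Var Z \<bullet> Var f \<^bold>= Var Y \<bullet> Var f))))))"

lemma wff_le2_one [simp]: "tyof t = Some type2 \<Longrightarrow> wff (t \<^bold>\<le>\<^sub>2 \<^bold>1)"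
  by (simp add: le2_one_def le_def Let_def)

lemma wff_STP2: "wff STP2"
  by (simp add: STP2_def Let_def)

lemma wff_STP2_normal_form: "wff STP2_normal_form"
  by (simp add: STP2_normal_form_def Let_def)

lemma tyof_subst_tm:
  "tyof s = Some (snd x) \<Longrightarrow> tyof (subst_tm x s t) = tyof t"
  by (induction t) (auto split: option.split ty.split)

lemma wff_subst: "tyof s = Some (snd x) \<Longrightarrow> wff (subst x s \<phi>) = wff \<phi>"
  by (induction \<phi>) (auto simp: tyof_subst_tm)

lemma wff_P_sys:
  assumes "\<phi> \<in> P_sys"
  shows "wff \<phi>"
proof -
  have "\<phi> \<in> EPA \<Longrightarrow> wff \<phi>"
    by (induction rule: EPA.induct) (simp_all add: wff_subst)
  moreover have "\<phi> \<in> Tst \<Longrightarrow> wff \<phi>"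
    by (induction rule: Tst.induct) simp_all
  moreover have "\<phi> \<in> IAst \<Longrightarrow> wff \<phi>"
    by (induction rule: IAst.induct) (simp_all add: wff_subst)
  moreover have "\<phi> \<in> Ideal \<Longrightarrow> wff \<phi>"
    by (induction rule: Ideal.induct) simp_all
  moreover have "\<phi> \<in> HACint \<Longrightarrow> wff \<phi>"
    by (induction rule: HACint.induct) simp_all
  ultimately show ?thesis
    using assms by (auto simp: P_sys_def)
qed

lemma deriv_wff: "T; H \<turnstile> \<phi> \<Longrightarrow> wff \<phi>"
  by (induction rule: deriv.induct) (simp_all add: wff_subst)

end

theory Submission
  imports Defs
begin

text \<open>From the standard part principle to the normal form: a standard part \<open>Z\<close> of
  \<open>Y\<close> agrees with \<open>Y\<close> on all of \<open>\<Psi>(Z)\<close>, because members of a standard sequence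
  are standard; the contrapositive of idealization then collects the finitely many
  \<open>Z\<close> needed for all \<open>Y\<close>. Conversely, if \<open>Y\<close> has no standard part, then every
  standard \<open>Z\<close> has a standard \<open>f\<close> with \<open>min(Z(f), 1) \<noteq> Y(f)\<close>, and \<open>HACint\<close> provides a standard
  \<open>\<Psi>\<close> bounding \<open>f\<close> in terms of \<open>Z\<close>, contradicting the normal form. Truncating at
  \<open>1\<close> is needed because the members of \<open>W\<close> are not required to be \<open>\<le>\<^sub>2 1\<close>.\<close>

section \<open>Entailment closed under weakening\<close>

abbreviation imps :: "fm list \<Rightarrow> fm \<Rightarrow> fm" where
  "imps \<Gamma> \<phi> \<equiv> foldr Imp \<Gamma> \<phi>"

lemma wff_imps [simp]: "wff (imps \<Gamma> \<phi>) \<longleftrightarrow> (\<forall>\<gamma>\<in>set \<Gamma>. wff \<gamma>) \<and> wff \<phi>"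
  by (induction \<Gamma>) auto

lemma deriv_impsI:
  "T; H \<union> set \<Gamma> \<turnstile> \<phi> \<Longrightarrow> \<forall>\<gamma>\<in>set \<Gamma>. wff \<gamma> \<Longrightarrow> T; H \<turnstile> imps \<Gamma> \<phi>"
  by (induction \<Gamma> arbitrary: H) (auto intro!: deriv.impI)

lemma deriv_impsE:
  "T; H \<turnstile> imps \<Gamma> \<phi> \<Longrightarrow> set \<Gamma> \<subseteq> H \<Longrightarrow> T; H \<turnstile> \<phi>"
proof (induction \<Gamma>)
  case (Cons \<gamma> \<Gamma>)
  then have "T; H \<turnstile> \<gamma>"
    using deriv_wff[OF Cons.prems(1)] by (auto intro: deriv.hyp)
  with Cons show ?case
    by (auto intro: deriv.impE)
qed simp

text \<open>Stands in for weakening: the first theorem enters the second derivation as one more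
  hypothesis. That hypothesis is discharged last and then removed by modus ponens with its own proof
  in the empty context.\<close>

lemma deriv_imps_cut:
  assumes "T; {} \<turnstile> imps \<Gamma> \<phi>" "T; insert (imps \<Gamma> \<phi>) (set \<Delta>) \<turnstile> \<psi>" "\<forall>\<gamma>\<in>set \<Delta>. wff \<gamma>"
  shows "T; {} \<turnstile> imps \<Delta> \<psi>"
proof -
  have "T; {imps \<Gamma> \<phi>} \<turnstile> imps \<Delta> \<psi>"
    using assms(2,3) by (intro deriv_impsI) simp_all
  then show ?thesis
    using assms(1) deriv_wff[OF assms(1)] by (blast intro: deriv.impE deriv.impI)
qed

lemma subst_tm_fresh [simp]: "x \<notin> fv_tm t \<Longrightarrow> subst_tm x s t = t"
  by (induction t) auto

lemma subst_tm_same [simp]: "subst_tm x (Var x) t = t"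
  by (induction t) auto

lemma subst_same [simp]: "subst x (Var x) \<phi> = \<phi>"
  by (induction \<phi>) auto

text \<open>A binder for another variable cannot capture \<open>x\<close>, and below a binder for
  \<open>x\<close> itself there is nothing to replace.\<close>

lemma freefor_same [simp]: "freefor (Var x) x \<phi>"
  by (induction \<phi>) auto

text \<open>The eigenvariable condition of \<open>allI\<close> speaks about all of \<open>H\<close>, so weakening
  would require renaming derivations. Recording the hypotheses as iterated
  premises of a theorem avoids this.\<close>

definition prv :: "fm set \<Rightarrow> fm \<Rightarrow> bool"  (\<open>_ \<tturnstile> _\<close> [50, 30] 30) where
  "(H \<tturnstile> \<phi>) \<longleftrightarrow> (\<exists>\<Gamma>. set \<Gamma> \<subseteq> H \<and> (P_sys; {} \<turnstile> imps \<Gamma> \<phi>))"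

section \<open>Structural and logical rules for \<open>prv\<close>\<close>

lemma prv_empty: "({} \<tturnstile> \<phi>) \<longleftrightarrow> (P_sys; {} \<turnstile> \<phi>)"
  by (auto simp: prv_def)

lemma prv_wff: "H \<tturnstile> \<phi> \<Longrightarrow> wff \<phi>"
  by (auto simp: prv_def dest: deriv_wff)

lemma prv_mono: "H \<tturnstile> \<phi> \<Longrightarrow> H \<subseteq> K \<Longrightarrow> K \<tturnstile> \<phi>"
  unfolding prv_def by blast

lemma prv_weaken: "{} \<tturnstile> \<phi> \<Longrightarrow> H \<tturnstile> \<phi>"
  by (rule prv_mono) auto

lemma prv_ax: "\<phi> \<in> P_sys \<Longrightarrow> H \<tturnstile> \<phi>"
  by (rule prv_weaken) (simp add: prv_empty deriv.ax wff_P_sys)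

lemma prv_hyp: "\<phi> \<in> H \<Longrightarrow> wff \<phi> \<Longrightarrow> H \<tturnstile> \<phi>"
  unfolding prv_def by (rule exI[of _ "[\<phi>]"]) (auto intro: deriv.impI deriv.hyp)

lemma prv_impI:
  assumes "insert \<phi> H \<tturnstile> \<psi>" "wff \<phi>"
  shows "H \<tturnstile> \<phi> \<^bold>\<longrightarrow> \<psi>"
proof -
  from assms(1) obtain \<Gamma> where \<Gamma>: "set \<Gamma> \<subseteq> insert \<phi> H" "P_sys; {} \<turnstile> imps \<Gamma> \<psi>"
    by (auto simp: prv_def)
  \<comment> \<open>\<open>\<phi>\<close> may occur in \<open>\<Gamma>\<close> any number of times.
    Dropping every occurrence leaves premises from \<open>H\<close>, and \<open>\<phi>\<close>
    returns once as the antecedent of the conclusion.\<close>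
  let ?\<Delta> = "removeAll \<phi> \<Gamma>"
  have wf: "\<forall>\<gamma>\<in>set \<Gamma>. wff \<gamma>" "wff \<psi>"
    using deriv_wff[OF \<Gamma>(2)] by auto
  have "P_sys; insert \<phi> (insert (imps \<Gamma> \<psi>) (set ?\<Delta>)) \<turnstile> \<psi>"
    by (rule deriv_impsE[of _ _ \<Gamma>]) (use wf in \<open>auto intro: deriv.hyp\<close>)
  then have "P_sys; {} \<turnstile> imps ?\<Delta> (\<phi> \<^bold>\<longrightarrow> \<psi>)"
    using wf assms(2) by (intro deriv_imps_cut[OF \<Gamma>(2)] deriv.impI) auto
  then show ?thesis
    using \<Gamma>(1) unfolding prv_def by (intro exI[of _ ?\<Delta>]) auto
qed

lemma prv_impE:
  assumes "H \<tturnstile> \<phi> \<^bold>\<longrightarrow> \<psi>" "H \<tturnstile> \<phi>"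
  shows "H \<tturnstile> \<psi>"
proof -
  from assms obtain \<Gamma> \<Delta> where
    \<Gamma>: "set \<Gamma> \<subseteq> H" "P_sys; {} \<turnstile> imps \<Gamma> (\<phi> \<^bold>\<longrightarrow> \<psi>)" and
    \<Delta>: "set \<Delta> \<subseteq> H" "P_sys; {} \<turnstile> imps \<Delta> \<phi>"
    by (auto simp: prv_def)
  have wf: "\<forall>\<gamma>\<in>set \<Gamma>. wff \<gamma>" "\<forall>\<gamma>\<in>set \<Delta>. wff \<gamma>" "wff \<phi>" "wff \<psi>"
    using deriv_wff[OF \<Gamma>(2)] deriv_wff[OF \<Delta>(2)] by auto
  \<comment> \<open>The cut lemma absorbs one theorem only. The other one heads the new list of
    premises and is removed at the end by modus ponens with its proof.\<close>
  let ?K = "insert (imps \<Delta> \<phi>) (set (imps \<Gamma> (\<phi> \<^bold>\<longrightarrow> \<psi>) # \<Gamma> @ \<Delta>))"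
  have "P_sys; ?K \<turnstile> \<phi> \<^bold>\<longrightarrow> \<psi>"
    by (rule deriv_impsE[of _ _ \<Gamma>]) (use wf in \<open>auto intro: deriv.hyp\<close>)
  moreover have "P_sys; ?K \<turnstile> \<phi>"
    by (rule deriv_impsE[of _ _ \<Delta>]) (use wf in \<open>auto intro: deriv.hyp\<close>)
  ultimately have "P_sys; ?K \<turnstile> \<psi>"
    by (rule deriv.impE)
  then have "P_sys; {} \<turnstile> imps (imps \<Gamma> (\<phi> \<^bold>\<longrightarrow> \<psi>) # \<Gamma> @ \<Delta>) \<psi>"
    by (rule deriv_imps_cut[OF \<Delta>(2)]) (use wf in auto)
  then have "P_sys; {} \<turnstile> imps (\<Gamma> @ \<Delta>) \<psi>"
    using deriv.impE[OF _ \<Gamma>(2)] by simp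
  then show ?thesis
    using \<Gamma>(1) \<Delta>(1) unfolding prv_def by (intro exI[of _ "\<Gamma> @ \<Delta>"]) auto
qed

lemma prv_absurd:
  assumes "(\<^bold>\<not> \<phi>) \<in> H" "H \<tturnstile> \<phi>"
  shows "H \<tturnstile> \<^bold>\<bottom>"
  by (rule prv_impE[OF prv_hyp[OF assms(1)] assms(2)]) (simp add: prv_wff[OF assms(2)])

text \<open>The classical rule \<open>deriv.raa\<close> enters here; \<open>prv_raa\<close> and the
  rules derived from it rest on this lemma. The short derivation is first closed into a theorem, so
  that it can be used in every context \<open>H\<close>.\<close>

lemma prv_dne:
  assumes "H \<tturnstile> \<^bold>\<not> \<^bold>\<not> \<phi>"
  shows "H \<tturnstile> \<phi>"
proof -
  have wf: "wff \<phi>"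
    using prv_wff[OF assms] by simp
  have "P_sys; {\<^bold>\<not> \<phi>, \<^bold>\<not> \<^bold>\<not> \<phi>} \<turnstile> \<^bold>\<bottom>"
    by (rule deriv.impE[of _ _ "\<^bold>\<not> \<phi>"]) (use wf in \<open>auto intro: deriv.hyp\<close>)
  then have "P_sys; {\<^bold>\<not> \<^bold>\<not> \<phi>} \<turnstile> \<phi>"
    using wf by (rule deriv.raa)
  then have "P_sys; {} \<turnstile> \<^bold>\<not> \<^bold>\<not> \<phi> \<^bold>\<longrightarrow> \<phi>"
    by (rule deriv.impI) (simp add: wf)
  then show ?thesis
    using prv_impE[OF prv_weaken assms] by (simp add: prv_empty)
qed

lemma prv_raa:
  assumes "insert (\<^bold>\<not> \<phi>) H \<tturnstile> \<^bold>\<bottom>" "wff \<phi>"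
  shows "H \<tturnstile> \<phi>"
  by (rule prv_dne, rule prv_impI[OF assms(1)]) (simp add: assms(2))

lemma prv_botE: "H \<tturnstile> \<^bold>\<bottom> \<Longrightarrow> wff \<phi> \<Longrightarrow> H \<tturnstile> \<phi>"
  by (rule prv_raa) (auto intro: prv_mono)

lemma prv_allI:
  assumes "H \<tturnstile> \<phi>" "\<forall>\<psi>\<in>H. x \<notin> fv \<psi>"
  shows "H \<tturnstile> \<^bold>\<forall>x. \<phi>"
proof -
  from assms(1) obtain \<Gamma> where \<Gamma>: "set \<Gamma> \<subseteq> H" "P_sys; {} \<turnstile> imps \<Gamma> \<phi>"
    by (auto simp: prv_def)
  have wf: "\<forall>\<gamma>\<in>set \<Gamma>. wff \<gamma>" "wff \<phi>"
    using deriv_wff[OF \<Gamma>(2)] by auto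
  \<comment> \<open>As a hypothesis, \<open>imps \<Gamma> \<phi>\<close> itself could have
    \<open>x\<close> free and block \<open>allI\<close>. Its generalization does not, and neither do
    the premises in \<open>\<Gamma>\<close>, which come from \<open>H\<close>.\<close>
  have all: "P_sys; {} \<turnstile> imps [] (\<^bold>\<forall>x. imps \<Gamma> \<phi>)"
    using \<Gamma>(2) by (auto intro: deriv.allI)
  let ?K = "insert (imps [] (\<^bold>\<forall>x. imps \<Gamma> \<phi>)) (set \<Gamma>)"
  have "P_sys; ?K \<turnstile> \<^bold>\<forall>x. imps \<Gamma> \<phi>"
    using wf by (auto intro: deriv.hyp)
  then have "P_sys; ?K \<turnstile> imps \<Gamma> \<phi>"
    using deriv.allE[of _ _ x "imps \<Gamma> \<phi>" "Var x"] by simp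
  then have "P_sys; ?K \<turnstile> \<phi>"
    by (rule deriv_impsE) auto
  then have "P_sys; ?K \<turnstile> \<^bold>\<forall>x. \<phi>"
    using assms(2) \<Gamma>(1) by (auto intro!: deriv.allI)
  then have "P_sys; {} \<turnstile> imps \<Gamma> (\<^bold>\<forall>x. \<phi>)"
    using wf by (intro deriv_imps_cut[OF all]) auto
  then show ?thesis
    using \<Gamma>(1) unfolding prv_def by blast
qed

lemma prv_allE:
  assumes "H \<tturnstile> \<^bold>\<forall>x. \<phi>" "tyof s = Some (snd x)" "freefor s x \<phi>"
  shows "H \<tturnstile> subst x s \<phi>"
proof -
  from assms(1) obtain \<Gamma> where \<Gamma>: "set \<Gamma> \<subseteq> H" "P_sys; {} \<turnstile> imps \<Gamma> (\<^bold>\<forall>x. \<phi>)"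
    by (auto simp: prv_def)
  have wf: "\<forall>\<gamma>\<in>set \<Gamma>. wff \<gamma>" "wff \<phi>"
    using deriv_wff[OF \<Gamma>(2)] by auto
  have "P_sys; insert (imps \<Gamma> (\<^bold>\<forall>x. \<phi>)) (set \<Gamma>) \<turnstile> \<^bold>\<forall>x. \<phi>"
    by (rule deriv_impsE[of _ _ \<Gamma>]) (use wf in \<open>auto intro: deriv.hyp\<close>)
  then have "P_sys; {} \<turnstile> imps \<Gamma> (subst x s \<phi>)"
    using wf assms by (intro deriv_imps_cut[OF \<Gamma>(2)] deriv.allE) auto
  then show ?thesis
    using \<Gamma>(1) unfolding prv_def by blast
qed

lemma prv_spec: "H \<tturnstile> \<^bold>\<forall>x. \<phi> \<Longrightarrow> H \<tturnstile> \<phi>"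
  using prv_allE[of H x \<phi> "Var x"] by simp

lemma prv_conjI:
  assumes "H \<tturnstile> \<phi>" "H \<tturnstile> \<psi>"
  shows "H \<tturnstile> \<phi> \<^bold>\<and> \<psi>"
proof (rule prv_impI)
  let ?K = "insert (\<phi> \<^bold>\<longrightarrow> \<^bold>\<not> \<psi>) H"
  show "wff (\<phi> \<^bold>\<longrightarrow> \<^bold>\<not> \<psi>)"
    using prv_wff[OF assms(1)] prv_wff[OF assms(2)] by simp
  then have "?K \<tturnstile> \<phi> \<^bold>\<longrightarrow> \<^bold>\<not> \<psi>"
    by (intro prv_hyp) auto
  moreover have "?K \<tturnstile> \<phi>" "?K \<tturnstile> \<psi>"
    using assms by (auto intro: prv_mono)
  ultimately show "?K \<tturnstile> \<^bold>\<bottom>"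
    by (rule prv_impE[OF prv_impE])
qed

text \<open>Conjunction is coded as the denial that the first part implies the negation of the
  second. If the first part fails, that implication holds vacuously, a contradiction.\<close>

lemma prv_conjD1:
  assumes "H \<tturnstile> \<phi> \<^bold>\<and> \<psi>"
  shows "H \<tturnstile> \<phi>"
proof (rule prv_raa)
  have wf: "wff \<phi>" "wff \<psi>"
    using prv_wff[OF assms] by auto
  then show "wff \<phi>" by simp
  have "insert \<phi> (insert (\<^bold>\<not> \<phi>) H) \<tturnstile> \<^bold>\<bottom>"
    by (rule prv_impE[of _ \<phi>]) (use wf in \<open>auto intro: prv_hyp\<close>)
  then have "insert \<phi> (insert (\<^bold>\<not> \<phi>) H) \<tturnstile> \<^bold>\<not> \<psi>"
    by (rule prv_botE) (simp add: wf)
  then have "insert (\<^bold>\<not> \<phi>) H \<tturnstile> \<phi> \<^bold>\<longrightarrow> \<^bold>\<not> \<psi>"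
    using wf(1) by (rule prv_impI)
  then show "insert (\<^bold>\<not> \<phi>) H \<tturnstile> \<^bold>\<bottom>"
    by (rule prv_impE[OF prv_mono[OF assms subset_insertI]])
qed

lemma prv_conjD2:
  assumes "H \<tturnstile> \<phi> \<^bold>\<and> \<psi>"
  shows "H \<tturnstile> \<psi>"
proof (rule prv_raa)
  have wf: "wff \<phi>" "wff \<psi>"
    using prv_wff[OF assms] by auto
  then show "wff \<psi>" by simp
  have "insert (\<^bold>\<not> \<psi>) H \<tturnstile> \<phi> \<^bold>\<longrightarrow> \<^bold>\<not> \<psi>"
    using wf by (intro prv_impI[of \<phi>] prv_hyp) auto
  then show "insert (\<^bold>\<not> \<psi>) H \<tturnstile> \<^bold>\<bottom>"
    by (rule prv_impE[OF prv_mono[OF assms subset_insertI]])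
qed

lemma prv_cases:
  assumes "insert \<phi> H \<tturnstile> \<psi>" "insert (\<^bold>\<not> \<phi>) H \<tturnstile> \<psi>" "wff \<phi>"
  shows "H \<tturnstile> \<psi>"
proof (rule prv_raa)
  show wf: "wff \<psi>"
    using prv_wff[OF assms(1)] .
  let ?K = "insert (\<^bold>\<not> \<psi>) H"
  have "insert \<phi> ?K \<tturnstile> \<psi>"
    by (rule prv_mono[OF assms(1)]) auto
  then have "insert \<phi> ?K \<tturnstile> \<^bold>\<bottom>"
    by (rule prv_absurd[rotated]) simp
  then have "?K \<tturnstile> \<^bold>\<not> \<phi>"
    using assms(3) by (rule prv_impI)
  moreover have "insert (\<^bold>\<not> \<phi>) ?K \<tturnstile> \<psi>"
    by (rule prv_mono[OF assms(2)]) auto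
  then have "?K \<tturnstile> \<^bold>\<not> \<phi> \<^bold>\<longrightarrow> \<psi>"
    using assms(3) by (intro prv_impI) auto
  ultimately have "?K \<tturnstile> \<psi>"
    by (rule prv_impE[rotated])
  then show "?K \<tturnstile> \<^bold>\<bottom>"
    by (rule prv_absurd[rotated]) simp
qed

text \<open>A disjunction is an implication from the negated left side, so deciding the left side
  yields one of the two cases.\<close>

lemma prv_disjE:
  assumes "H \<tturnstile> \<phi> \<^bold>\<or> \<psi>" "insert \<phi> H \<tturnstile> \<chi>" "insert \<psi> H \<tturnstile> \<chi>"
  shows "H \<tturnstile> \<chi>"
proof (rule prv_cases[OF assms(2)])
  have wf: "wff \<phi>" "wff \<psi>"
    using prv_wff[OF assms(1)] by auto
  then show "wff \<phi>" by simp
  have "insert (\<^bold>\<not> \<phi>) H \<tturnstile> \<psi>"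
    by (rule prv_impE[OF prv_mono[OF assms(1) subset_insertI] prv_hyp]) (use wf in auto)
  moreover have "insert (\<^bold>\<not> \<phi>) H \<tturnstile> \<psi> \<^bold>\<longrightarrow> \<chi>"
    using wf by (intro prv_impI prv_mono[OF assms(3)]) auto
  ultimately show "insert (\<^bold>\<not> \<phi>) H \<tturnstile> \<chi>"
    by (rule prv_impE[rotated])
qed

lemma prv_exI:
  assumes "H \<tturnstile> subst x s \<phi>" "tyof s = Some (snd x)" "freefor s x \<phi>"
  shows "H \<tturnstile> \<^bold>\<exists>x. \<phi>"
proof (rule prv_impI)
  let ?K = "insert (\<^bold>\<forall>x. \<^bold>\<not> \<phi>) H"
  show wf: "wff (\<^bold>\<forall>x. \<^bold>\<not> \<phi>)"
    using prv_wff[OF assms(1)] assms(2) by (simp add: wff_subst)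
  have "?K \<tturnstile> subst x s (\<^bold>\<not> \<phi>)"
    using wf assms by (intro prv_allE prv_hyp) auto
  then have "?K \<tturnstile> \<^bold>\<not> subst x s \<phi>"
    by simp
  then show "?K \<tturnstile> \<^bold>\<bottom>"
    by (rule prv_impE) (rule prv_mono[OF assms(1) subset_insertI])
qed

lemma prv_exI_same: "H \<tturnstile> \<phi> \<Longrightarrow> H \<tturnstile> \<^bold>\<exists>x. \<phi>"
  using prv_exI[of H x "Var x" \<phi>] by simp

text \<open>The existential quantifier is a negated universal one. If \<open>\<psi>\<close> failed,
  every candidate \<open>x\<close> would be refuted; the freshness conditions allow generalizing
  over \<open>x\<close>.\<close>

lemma prv_exE:
  assumes "H \<tturnstile> \<^bold>\<exists>x. \<phi>" "insert \<phi> H \<tturnstile> \<psi>" "x \<notin> fv \<psi>" "\<forall>\<chi>\<in>H. x \<notin> fv \<chi>"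
  shows "H \<tturnstile> \<psi>"
proof (rule prv_raa)
  show wf: "wff \<psi>"
    using prv_wff[OF assms(2)] .
  let ?K = "insert (\<^bold>\<not> \<psi>) H"
  have "insert \<phi> ?K \<tturnstile> \<^bold>\<bottom>"
    by (rule prv_absurd[OF _ prv_mono[OF assms(2)]]) auto
  then have "?K \<tturnstile> \<^bold>\<forall>x. \<^bold>\<not> \<phi>"
    using assms(3,4) prv_wff[OF assms(1)] by (intro prv_allI prv_impI) auto
  then show "?K \<tturnstile> \<^bold>\<bottom>"
    by (rule prv_impE[OF prv_mono[OF assms(1) subset_insertI]])
qed


section \<open>Equality\<close>

lemma finite_fv_tm [simp]: "finite (fv_tm t)"
  by (induction t) auto

text \<open>Names are strings, so each type has infinitely many variables.\<close>

lemma fresh_var_exists: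
  assumes "finite A"
  obtains x :: var where "snd x = \<tau>" "x \<notin> A"
proof -
  have "infinite (range (\<lambda>s :: string. (s, \<tau>)))"
    by (simp add: finite_image_iff inj_on_def infinite_UNIV_listI)
  then obtain x where "x \<in> range (\<lambda>s :: string. (s, \<tau>))" "x \<notin> A"
    using assms by (meson finite_subset subsetI)
  then show ?thesis
    using that[of x] by auto
qed

lemma prv_EPA: "\<phi> \<in> EPA \<Longrightarrow> H \<tturnstile> \<phi>"
  by (rule prv_ax) (simp add: P_sys_def)

lemma prv_Tst: "\<phi> \<in> Tst \<Longrightarrow> H \<tturnstile> \<phi>"
  by (rule prv_ax) (simp add: P_sys_def)

lemma prv_refl: "tyof t = Some \<sigma> \<Longrightarrow> H \<tturnstile> t \<^bold>= t"
  by (rule prv_EPA) (rule EPA.refl)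

lemma prv_eq_tyof: "H \<tturnstile> t \<^bold>= u \<Longrightarrow> \<exists>\<sigma>. tyof t = Some \<sigma> \<and> tyof u = Some \<sigma>"
  by (drule prv_wff) (auto dest: sym)

text \<open>The Leibniz axiom for an equation: without quantifiers, no capture is possible.
  Symmetry, transitivity and the congruence rules follow by choosing the equation and taking a fresh
  \<open>x\<close> as the place of replacement.\<close>

lemma prv_subst_eq:
  assumes "H \<tturnstile> t \<^bold>= u" "H \<tturnstile> subst_tm x t a \<^bold>= subst_tm x t b" "tyof t = Some (snd x)"
  shows "H \<tturnstile> subst_tm x u a \<^bold>= subst_tm x u b"
proof -
  have u: "tyof u = Some (snd x)"
    using prv_eq_tyof[OF assms(1)] assms(3) by auto
  have "wff (subst x t (a \<^bold>= b))"
    using prv_wff[OF assms(2)] by (simp only: subst.simps)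
  then have "(t \<^bold>= u \<^bold>\<longrightarrow> subst x t (a \<^bold>= b) \<^bold>\<longrightarrow> subst x u (a \<^bold>= b)) \<in> EPA"
    using u assms(3) by (intro EPA.leibniz) (simp_all only: wff_subst internal.simps freefor.simps)
  from prv_impE[OF prv_impE[OF prv_EPA[OF this] assms(1)]] show ?thesis
    using assms(2) by simp
qed

lemma prv_sym:
  assumes "H \<tturnstile> t \<^bold>= u"
  shows "H \<tturnstile> u \<^bold>= t"
proof -
  obtain \<sigma> where \<sigma>: "tyof t = Some \<sigma>"
    using prv_eq_tyof[OF assms] by auto
  obtain x where "snd x = \<sigma>" "x \<notin> fv_tm t"
    by (rule fresh_var_exists[OF finite_fv_tm])
  then show ?thesis
    using prv_subst_eq[OF assms, of x "Var x" t] prv_refl[OF \<sigma>] \<sigma> by simp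
qed

lemma prv_trans:
  assumes "H \<tturnstile> t \<^bold>= u" "H \<tturnstile> u \<^bold>= v"
  shows "H \<tturnstile> t \<^bold>= v"
proof -
  obtain \<sigma> where \<sigma>: "tyof u = Some \<sigma>"
    using prv_eq_tyof[OF assms(1)] by auto
  obtain x where "snd x = \<sigma>" "x \<notin> fv_tm t"
    by (rule fresh_var_exists[OF finite_fv_tm])
  then show ?thesis
    using prv_subst_eq[OF assms(2), of x t "Var x"] assms(1) \<sigma> by simp
qed

lemma prv_cong_arg:
  assumes "H \<tturnstile> t \<^bold>= u" "tyof f = Some (\<sigma> \<^bold>\<Rightarrow> \<tau>)" "tyof t = Some \<sigma>"
  shows "H \<tturnstile> f \<bullet> t \<^bold>= f \<bullet> u"
proof -
  obtain x where "snd x = \<sigma>" "x \<notin> fv_tm (f \<bullet> t)"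
    by (rule fresh_var_exists[OF finite_fv_tm])
  then show ?thesis
    using prv_subst_eq[OF assms(1), of x "f \<bullet> t" "f \<bullet> Var x"] prv_refl[of "f \<bullet> t" \<tau>] assms
    by simp
qed

lemma prv_cong_fun:
  assumes "H \<tturnstile> f \<^bold>= g" "tyof f = Some (\<sigma> \<^bold>\<Rightarrow> \<tau>)" "tyof t = Some \<sigma>"
  shows "H \<tturnstile> f \<bullet> t \<^bold>= g \<bullet> t"
proof -
  obtain x where "snd x = \<sigma> \<^bold>\<Rightarrow> \<tau>" "x \<notin> fv_tm (f \<bullet> t)"
    by (rule fresh_var_exists[OF finite_fv_tm])
  then show ?thesis
    using prv_subst_eq[OF assms(1), of x "f \<bullet> t" "Var x \<bullet> t"] prv_refl[of "f \<bullet> t" \<tau>] assms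
    by simp
qed

text \<open>The Leibniz axiom covers internal formulas only, so replacement under \<open>St\<close>
  goes through an axiom of \<open>Tst\<close>.\<close>

lemma prv_St_eq:
  assumes "H \<tturnstile> St t" "H \<tturnstile> t \<^bold>= u"
  shows "H \<tturnstile> St u"
proof -
  have "(St t \<^bold>\<and> t \<^bold>= u \<^bold>\<longrightarrow> St u) \<in> Tst"
    using prv_eq_tyof[OF assms(2)] Tst.eq by blast
  from prv_impE[OF prv_Tst[OF this] prv_conjI] show ?thesis
    using assms .
qed

lemma prv_St_app:
  assumes "H \<tturnstile> St f" "H \<tturnstile> St t" "tyof f = Some (\<sigma> \<^bold>\<Rightarrow> \<tau>)" "tyof t = Some \<sigma>"
  shows "H \<tturnstile> St (f \<bullet> t)"
  by (rule prv_impE[OF prv_Tst[OF Tst.app[OF assms(3,4)]] prv_conjI[OF assms(1,2)]])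

lemma prv_St_closed: "tyof t = Some \<sigma> \<Longrightarrow> fv_tm t = {} \<Longrightarrow> H \<tturnstile> St t"
  by (rule prv_Tst) (rule Tst.closed)


section \<open>Arithmetic\<close>

lemma fv_comp_tm [simp]: "fv_tm (comp_tm \<alpha> \<beta> \<gamma> g f) = fv_tm g \<union> fv_tm f"
  by (simp add: comp_tm_def)

lemma subst_comp_tm [simp]:
  "subst_tm x s (comp_tm \<alpha> \<beta> \<gamma> g f) = comp_tm \<alpha> \<beta> \<gamma> (subst_tm x s g) (subst_tm x s f)"
  by (simp add: comp_tm_def)

lemma fv_id_tm [simp]: "fv_tm (id_tm \<alpha>) = {}"
  by (simp add: id_tm_def)

lemma fv_pred_tm [simp]: "fv_tm pred_tm = {}"
  by (simp add: pred_tm_def)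

lemma fv_monus [simp]: "fv_tm (monus t u) = fv_tm t \<union> fv_tm u"
  by (simp add: monus_def)

lemma subst_monus [simp]:
  "subst_tm x s (monus t u) = monus (subst_tm x s t) (subst_tm x s u)"
  by (simp add: monus_def)

lemma fv_default_tm [simp]: "fv_tm (default_tm \<sigma>) = {}"
  by (induction \<sigma>) auto

lemma fv_len_tm [simp]: "fv_tm (len_tm \<sigma>) = {}"
  by (simp add: len_tm_def)

lemma fv_nth_tm [simp]: "fv_tm (nth_tm \<sigma>) = {}"
  by (simp add: nth_tm_def Let_def)

lemma prv_comp:
  assumes "tyof g = Some (\<beta> \<^bold>\<Rightarrow> \<gamma>)" "tyof f = Some (\<alpha> \<^bold>\<Rightarrow> \<beta>)" "tyof t = Some \<alpha>"
  shows "H \<tturnstile> comp_tm \<alpha> \<beta> \<gamma> g f \<bullet> t \<^bold>= g \<bullet> (f \<bullet> t)"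
proof -
  let ?P = "Con (Pi (\<beta> \<^bold>\<Rightarrow> \<gamma>) \<alpha>) \<bullet> g"
  have "H \<tturnstile> comp_tm \<alpha> \<beta> \<gamma> g f \<bullet> t \<^bold>= ?P \<bullet> t \<bullet> (f \<bullet> t)"
    unfolding comp_tm_def by (rule prv_EPA, rule EPA.Sig) (use assms in auto)
  moreover have "H \<tturnstile> ?P \<bullet> t \<^bold>= g"
    by (rule prv_EPA, rule EPA.Pi) (use assms in auto)
  then have "H \<tturnstile> ?P \<bullet> t \<bullet> (f \<bullet> t) \<^bold>= g \<bullet> (f \<bullet> t)"
    by (rule prv_cong_fun) (use assms in auto)
  ultimately show ?thesis
    by (rule prv_trans)
qed

lemma prv_id:
  assumes "tyof t = Some \<alpha>"
  shows "H \<tturnstile> id_tm \<alpha> \<bullet> t \<^bold>= t"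
proof -
  have "H \<tturnstile> id_tm \<alpha> \<bullet> t \<^bold>= Con (Pi \<alpha> (\<alpha> \<^bold>\<Rightarrow> \<alpha>)) \<bullet> t \<bullet> (Con (Pi \<alpha> \<alpha>) \<bullet> t)"
    unfolding id_tm_def by (rule prv_EPA, rule EPA.Sig) (use assms in auto)
  moreover have "H \<tturnstile> Con (Pi \<alpha> (\<alpha> \<^bold>\<Rightarrow> \<alpha>)) \<bullet> t \<bullet> (Con (Pi \<alpha> \<alpha>) \<bullet> t) \<^bold>= t"
    by (rule prv_EPA, rule EPA.Pi) (use assms in auto)
  ultimately show ?thesis
    by (rule prv_trans)
qed

lemma prv_pred_zero: "H \<tturnstile> pred_tm \<bullet> zero \<^bold>= zero"
  unfolding pred_tm_def by (rule prv_EPA, rule EPA.Rec_zero) auto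

lemma prv_pred_suc:
  assumes "tyof t = Some N"
  shows "H \<tturnstile> pred_tm \<bullet> suc t \<^bold>= t"
proof -
  let ?P = "Con (Pi (N \<^bold>\<Rightarrow> N) N) \<bullet> id_tm N"
  have "H \<tturnstile> pred_tm \<bullet> suc t \<^bold>= ?P \<bullet> (pred_tm \<bullet> t) \<bullet> t"
    unfolding pred_tm_def by (rule prv_EPA, rule EPA.Rec_suc) (use assms in auto)
  moreover have "H \<tturnstile> ?P \<bullet> (pred_tm \<bullet> t) \<^bold>= id_tm N"
    by (rule prv_EPA, rule EPA.Pi) (use assms in auto)
  then have "H \<tturnstile> ?P \<bullet> (pred_tm \<bullet> t) \<bullet> t \<^bold>= id_tm N \<bullet> t"
    by (rule prv_cong_fun) (use assms in auto)
  ultimately show ?thesis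
    using prv_id[OF assms] by (rule prv_trans[OF prv_trans])
qed

lemma prv_monus_zero: "tyof t = Some N \<Longrightarrow> H \<tturnstile> monus t zero \<^bold>= t"
  unfolding monus_def by (rule prv_EPA, rule EPA.Rec_zero) auto

lemma prv_monus_suc:
  assumes "tyof t = Some N" "tyof u = Some N"
  shows "H \<tturnstile> monus t (suc u) \<^bold>= pred_tm \<bullet> monus t u"
proof -
  let ?P = "comp_tm N N (N \<^bold>\<Rightarrow> N) (Con (Pi N N)) pred_tm"
  have "H \<tturnstile> monus t (suc u) \<^bold>= ?P \<bullet> monus t u \<bullet> u"
    unfolding monus_def by (rule prv_EPA, rule EPA.Rec_suc) (use assms in auto)
  moreover have "H \<tturnstile> ?P \<bullet> monus t u \<^bold>= Con (Pi N N) \<bullet> (pred_tm \<bullet> monus t u)"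
    by (rule prv_comp) (use assms in auto)
  then have "H \<tturnstile> ?P \<bullet> monus t u \<bullet> u \<^bold>= Con (Pi N N) \<bullet> (pred_tm \<bullet> monus t u) \<bullet> u"
    by (rule prv_cong_fun) (use assms in auto)
  moreover have "H \<tturnstile> Con (Pi N N) \<bullet> (pred_tm \<bullet> monus t u) \<bullet> u \<^bold>= pred_tm \<bullet> monus t u"
    by (rule prv_EPA, rule EPA.Pi) (use assms in auto)
  ultimately show ?thesis
    by (rule prv_trans[OF prv_trans])
qed

text \<open>Once the induction hypothesis is discharged the context is empty, so generalizing over
  \<open>n\<close> meets no obstacle. Results proved this way reach other contexts through
  \<open>prv_weaken\<close>.\<close>

lemma prv_induct:
  assumes "{} \<tturnstile> subst n zero \<phi>" "{\<phi>} \<tturnstile> subst n (suc (Var n)) \<phi>"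
    and "internal \<phi>" "snd n = N" "freefor (suc (Var n)) n \<phi>"
  shows "{} \<tturnstile> \<phi>"
proof -
  have wf: "wff \<phi>"
    using prv_wff[OF assms(1)] assms(4) by (simp add: wff_subst)
  have "{} \<tturnstile> \<^bold>\<forall>n. (\<phi> \<^bold>\<longrightarrow> subst n (suc (Var n)) \<phi>)"
    using wf assms by (intro prv_allI prv_impI) auto
  from prv_impE[OF prv_EPA[OF EPA.ind] prv_conjI[OF assms(1) this]] show ?thesis
    using wf assms by (blast intro: prv_spec)
qed

text \<open>Induction serves as a case split. Naming the predecessor by a term spares later case
  distinctions an existential variable and its freshness conditions.\<close>

lemma prv_nat_cases:
  assumes "tyof t = Some N"
  shows "H \<tturnstile> t \<^bold>= zero \<^bold>\<or> t \<^bold>= suc (pred_tm \<bullet> t)"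
proof -
  define n where "n = (''n'', N)"
  let ?\<phi> = "Var n \<^bold>= zero \<^bold>\<or> Var n \<^bold>= suc (pred_tm \<bullet> Var n)"
  have n: "snd n = N"
    by (simp add: n_def)
  have "{} \<tturnstile> ?\<phi>"
  proof (rule prv_induct)
    have "{\<^bold>\<not> zero \<^bold>= zero} \<tturnstile> \<^bold>\<bottom>"
      by (rule prv_absurd[OF _ prv_refl]) auto
    then show "{} \<tturnstile> subst n zero ?\<phi>"
      by (auto intro!: prv_impI elim!: prv_botE)
    have "{\<^bold>\<not> suc (Var n) \<^bold>= zero, ?\<phi>} \<tturnstile> suc (Var n) \<^bold>= suc (pred_tm \<bullet> suc (Var n))"
      using n by (intro prv_cong_arg[where \<sigma> = N and \<tau> = N] prv_sym[OF prv_pred_suc]) auto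
    then show "{?\<phi>} \<tturnstile> subst n (suc (Var n)) ?\<phi>"
      using n by (auto intro!: prv_impI)
  qed (use n in auto)
  then have "{} \<tturnstile> subst n t ?\<phi>"
    using assms n by (intro prv_allE[OF prv_allI]) auto
  then show ?thesis
    by (auto intro: prv_weaken)
qed

text \<open>Subtraction recurses on its second argument, hence induction there: at zero the
  predecessor undoes the successor, and each further step applies the predecessor on both
  sides.\<close>

lemma prv_monus_suc_suc:
  assumes "tyof t = Some N" "tyof u = Some N"
  shows "H \<tturnstile> monus (suc t) (suc u) \<^bold>= monus t u"
proof -
  obtain n :: var where n: "snd n = N" "n \<notin> fv_tm t"
    by (rule fresh_var_exists[OF finite_fv_tm])
  let ?\<phi> = "monus (suc t) (suc (Var n)) \<^bold>= monus t (Var n)"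
  have "{} \<tturnstile> ?\<phi>"
  proof (rule prv_induct)
    have "{} \<tturnstile> monus (suc t) (suc zero) \<^bold>= pred_tm \<bullet> monus (suc t) zero"
      by (rule prv_monus_suc) (use assms in auto)
    moreover have "{} \<tturnstile> pred_tm \<bullet> monus (suc t) zero \<^bold>= pred_tm \<bullet> suc t"
      by (rule prv_cong_arg[OF prv_monus_zero]) (use assms in auto)
    moreover have "{} \<tturnstile> pred_tm \<bullet> suc t \<^bold>= t"
      by (rule prv_pred_suc) (use assms in auto)
    moreover have "{} \<tturnstile> t \<^bold>= monus t zero"
      by (rule prv_sym[OF prv_monus_zero]) (use assms in auto)
    ultimately have "{} \<tturnstile> monus (suc t) (suc zero) \<^bold>= monus t zero"
      by (rule prv_trans[OF prv_trans[OF prv_trans]])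
    then show "{} \<tturnstile> subst n zero ?\<phi>"
      using n by simp
  next
    have "{?\<phi>} \<tturnstile> monus (suc t) (suc (suc (Var n))) \<^bold>= pred_tm \<bullet> monus (suc t) (suc (Var n))"
      by (rule prv_monus_suc) (use assms n in auto)
    moreover have "{?\<phi>} \<tturnstile> pred_tm \<bullet> monus (suc t) (suc (Var n)) \<^bold>= pred_tm \<bullet> monus t (Var n)"
      by (rule prv_cong_arg[OF prv_hyp]) (use assms n in auto)
    moreover have "{?\<phi>} \<tturnstile> pred_tm \<bullet> monus t (Var n) \<^bold>= monus t (suc (Var n))"
      by (rule prv_sym[OF prv_monus_suc]) (use assms n in auto)
    ultimately have "{?\<phi>} \<tturnstile> monus (suc t) (suc (suc (Var n))) \<^bold>= monus t (suc (Var n))"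
      by (rule prv_trans[OF prv_trans])
    then show "{?\<phi>} \<tturnstile> subst n (suc (Var n)) ?\<phi>"
      using n by simp
  qed (use n in auto)
  then have "{} \<tturnstile> subst n u ?\<phi>"
    using assms n by (intro prv_allE[OF prv_allI]) auto
  then show ?thesis
    using n by (auto intro: prv_weaken)
qed

lemma prv_monus_cong:
  assumes "H \<tturnstile> t \<^bold>= u" "tyof t = Some N" "tyof v = Some N"
  shows "H \<tturnstile> monus t v \<^bold>= monus u v"
  unfolding monus_def
  by (rule prv_cong_fun[OF prv_cong_fun[OF prv_cong_arg[OF assms(1)]]]) (use assms in auto)

text \<open>Since \<open>le\<close> is defined through \<open>monus\<close>, this turns the bound
  \<open>suc zero\<close> into the statement that the predecessor vanishes.\<close>

lemma prv_monus_one: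
  assumes "tyof t = Some N"
  shows "H \<tturnstile> monus t (suc zero) \<^bold>= pred_tm \<bullet> t"
proof (rule prv_trans)
  show "H \<tturnstile> monus t (suc zero) \<^bold>= pred_tm \<bullet> monus t zero"
    by (rule prv_monus_suc) (use assms in auto)
  show "H \<tturnstile> pred_tm \<bullet> monus t zero \<^bold>= pred_tm \<bullet> t"
    by (rule prv_cong_arg[OF prv_monus_zero]) (use assms in auto)
qed

text \<open>\<open>sg_tm\<close> computes \<open>min(n, 1)\<close>.\<close>

definition sg_tm :: tm where
  "sg_tm = Con (Rec N) \<bullet> zero \<bullet> (Con (Pi (N \<^bold>\<Rightarrow> N) N) \<bullet> (Con (Pi N N) \<bullet> suc zero))"

lemma tyof_sg_tm [simp]: "tyof sg_tm = Some (N \<^bold>\<Rightarrow> N)"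
  by (simp add: sg_tm_def)

lemma fv_sg_tm [simp]: "fv_tm sg_tm = {}"
  by (simp add: sg_tm_def)

lemma prv_sg_zero: "H \<tturnstile> sg_tm \<bullet> zero \<^bold>= zero"
  unfolding sg_tm_def by (rule prv_EPA, rule EPA.Rec_zero) auto

lemma prv_sg_suc:
  assumes "tyof t = Some N"
  shows "H \<tturnstile> sg_tm \<bullet> suc t \<^bold>= suc zero"
proof -
  let ?Q = "Con (Pi N N) \<bullet> suc zero"
  let ?P = "Con (Pi (N \<^bold>\<Rightarrow> N) N) \<bullet> ?Q"
  have "H \<tturnstile> sg_tm \<bullet> suc t \<^bold>= ?P \<bullet> (sg_tm \<bullet> t) \<bullet> t"
    unfolding sg_tm_def by (rule prv_EPA, rule EPA.Rec_suc) (use assms in auto)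
  moreover have "H \<tturnstile> ?P \<bullet> (sg_tm \<bullet> t) \<^bold>= ?Q"
    by (rule prv_EPA, rule EPA.Pi) (use assms in auto)
  then have "H \<tturnstile> ?P \<bullet> (sg_tm \<bullet> t) \<bullet> t \<^bold>= ?Q \<bullet> t"
    by (rule prv_cong_fun) (use assms in auto)
  moreover have "H \<tturnstile> ?Q \<bullet> t \<^bold>= suc zero"
    by (rule prv_EPA, rule EPA.Pi) (use assms in auto)
  ultimately show ?thesis
    by (rule prv_trans[OF prv_trans])
qed

lemma prv_sg_of_zero:
  assumes "H \<tturnstile> t \<^bold>= zero" "tyof t = Some N"
  shows "H \<tturnstile> sg_tm \<bullet> t \<^bold>= zero"
  by (rule prv_trans[OF prv_cong_arg[OF assms(1)] prv_sg_zero]) (use assms in auto)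

lemma prv_sg_of_suc:
  assumes "H \<tturnstile> t \<^bold>= suc u" "tyof t = Some N" "tyof u = Some N"
  shows "H \<tturnstile> sg_tm \<bullet> t \<^bold>= suc zero"
  by (rule prv_trans[OF prv_cong_arg[OF assms(1)] prv_sg_suc]) (use assms in auto)

lemma prv_sg_le_one:
  assumes "tyof t = Some N"
  shows "H \<tturnstile> sg_tm \<bullet> t \<^bold>\<le> suc zero"
proof (rule prv_disjE[OF prv_nat_cases[OF assms]])
  have le: "K \<tturnstile> sg_tm \<bullet> t \<^bold>\<le> suc zero" if "K \<tturnstile> pred_tm \<bullet> (sg_tm \<bullet> t) \<^bold>= zero" for K
    unfolding le_def by (rule prv_trans[OF prv_monus_one that]) (simp add: assms)
  let ?K = "insert (t \<^bold>= zero) H"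
  have "?K \<tturnstile> sg_tm \<bullet> t \<^bold>= zero"
    by (rule prv_sg_of_zero[OF prv_hyp]) (auto simp: assms)
  then have "?K \<tturnstile> pred_tm \<bullet> (sg_tm \<bullet> t) \<^bold>= pred_tm \<bullet> zero"
    by (rule prv_cong_arg) (auto simp: assms)
  then show "?K \<tturnstile> sg_tm \<bullet> t \<^bold>\<le> suc zero"
    by (rule le[OF prv_trans[OF _ prv_pred_zero]])
  let ?L = "insert (t \<^bold>= suc (pred_tm \<bullet> t)) H"
  have "?L \<tturnstile> sg_tm \<bullet> t \<^bold>= suc zero"
    by (rule prv_sg_of_suc[OF prv_hyp]) (auto simp: assms)
  then have "?L \<tturnstile> pred_tm \<bullet> (sg_tm \<bullet> t) \<^bold>= pred_tm \<bullet> suc zero"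
    by (rule prv_cong_arg) (auto simp: assms)
  then show "?L \<tturnstile> sg_tm \<bullet> t \<^bold>\<le> suc zero"
    by (rule le[OF prv_trans[OF _ prv_pred_suc]]) simp
qed

text \<open>A nonzero \<open>t\<close> is the successor of its predecessor, and the bound forces
  that predecessor to be zero, so \<open>t\<close> is one.\<close>

lemma prv_sg_fixed:
  assumes "H \<tturnstile> t \<^bold>\<le> suc zero" "tyof t = Some N"
  shows "H \<tturnstile> sg_tm \<bullet> t \<^bold>= t"
proof (rule prv_disjE[OF prv_nat_cases[OF assms(2)]])
  let ?K = "insert (t \<^bold>= zero) H"
  have K: "?K \<tturnstile> t \<^bold>= zero"
    by (rule prv_hyp) (auto simp: assms)
  show "?K \<tturnstile> sg_tm \<bullet> t \<^bold>= t"
    by (rule prv_trans[OF prv_sg_of_zero[OF K assms(2)] prv_sym[OF K]])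
  let ?L = "insert (t \<^bold>= suc (pred_tm \<bullet> t)) H"
  have L: "?L \<tturnstile> t \<^bold>= suc (pred_tm \<bullet> t)"
    by (rule prv_hyp) (auto simp: assms)
  have "?L \<tturnstile> monus t (suc zero) \<^bold>= zero"
    using prv_mono[OF assms(1) subset_insertI] by (simp add: le_def)
  then have "?L \<tturnstile> pred_tm \<bullet> t \<^bold>= zero"
    by (rule prv_trans[OF prv_sym[OF prv_monus_one[OF assms(2)]]])
  then have "?L \<tturnstile> suc (pred_tm \<bullet> t) \<^bold>= suc zero"
    by (rule prv_cong_arg) (auto simp: assms)
  then have "?L \<tturnstile> t \<^bold>= suc zero"
    by (rule prv_trans[OF L])
  then show "?L \<tturnstile> sg_tm \<bullet> t \<^bold>= t"
    by (rule prv_trans[OF prv_sg_of_suc[OF L] prv_sym, rotated 2]) (auto simp: assms)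
qed


section \<open>Standard elements\<close>

text \<open>Standard numbers form an initial segment. The claim contains \<open>St\<close>, so it is
  proved by external induction on the bound, quantifying over all smaller \<open>i\<close> at
  once.\<close>

lemma prv_St_less:
  assumes "H \<tturnstile> t \<^bold>< u" "H \<tturnstile> St u" "tyof t = Some N" "tyof u = Some N"
  shows "H \<tturnstile> St t"
proof -
  obtain i :: var where i: "snd i = N" "i \<notin> fv_tm u"
    by (rule fresh_var_exists[OF finite_fv_tm])
  obtain n :: var where n: "snd n = N" "n \<notin> {i}"
    by (rule fresh_var_exists[of "{i}"]) simp
  then have "n \<noteq> i" "i \<noteq> n"
    by auto
  note [simp] = i n(1) this
  \<comment> \<open>The order is written out as a \<open>monus\<close> equation, on which the
    substitution rules compute. At bound zero the premise would make a successor equal to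
    zero.\<close>
  let ?\<phi> = "\<^bold>\<forall>i. (monus (suc (Var i)) (Var n) \<^bold>= zero \<^bold>\<longrightarrow> St (Var i))"
  have "{monus (suc (Var i)) zero \<^bold>= zero} \<tturnstile> suc (Var i) \<^bold>= zero"
    by (rule prv_trans[OF prv_sym[OF prv_monus_zero] prv_hyp]) auto
  then have "{monus (suc (Var i)) zero \<^bold>= zero} \<tturnstile> \<^bold>\<bottom>"
    by (rule prv_impE[OF prv_EPA[OF EPA.suc_nonzero], rotated]) simp
  then have "{monus (suc (Var i)) zero \<^bold>= zero} \<tturnstile> St (Var i)"
    by (rule prv_botE) simp
  then have base: "{} \<tturnstile> subst n zero ?\<phi>"
    by (auto intro!: prv_allI prv_impI)
  let ?h = "monus (suc (Var i)) (suc (Var n)) \<^bold>= zero"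
  let ?K = "{?h, ?\<phi>, St (Var n)}"
  have "?K \<tturnstile> St (Var i)"
  proof (rule prv_disjE[OF prv_nat_cases])
    let ?L = "insert (Var i \<^bold>= zero) ?K"
    show "?L \<tturnstile> St (Var i)"
      by (rule prv_St_eq[OF prv_St_closed prv_sym[OF prv_hyp]]) auto
    let ?L = "insert (Var i \<^bold>= suc (pred_tm \<bullet> Var i)) ?K"
    have eq: "?L \<tturnstile> Var i \<^bold>= suc (pred_tm \<bullet> Var i)"
      by (rule prv_hyp) auto
    \<comment> \<open>Cancelling successors leaves \<open>i\<close> at most \<open>n\<close>. As
      \<open>i\<close> is the successor of its predecessor, that predecessor is below
      \<open>n\<close>, and the induction hypothesis makes it standard.\<close>
    have "?L \<tturnstile> monus (Var i) (Var n) \<^bold>= zero"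
      by (rule prv_trans[OF prv_sym[OF prv_monus_suc_suc] prv_hyp]) auto
    then have less: "?L \<tturnstile> monus (suc (pred_tm \<bullet> Var i)) (Var n) \<^bold>= zero"
      by (rule prv_trans[OF prv_sym[OF prv_monus_cong[OF eq]], rotated 2]) auto
    have "?L \<tturnstile> subst i (pred_tm \<bullet> Var i) (monus (suc (Var i)) (Var n) \<^bold>= zero \<^bold>\<longrightarrow> St (Var i))"
      by (rule prv_allE[OF prv_hyp]) auto
    then have "?L \<tturnstile> monus (suc (pred_tm \<bullet> Var i)) (Var n) \<^bold>= zero \<^bold>\<longrightarrow> St (pred_tm \<bullet> Var i)"
      by simp
    then have "?L \<tturnstile> St (pred_tm \<bullet> Var i)"
      using less by (rule prv_impE)
    then have "?L \<tturnstile> St (suc (pred_tm \<bullet> Var i))"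
      by (rule prv_St_app[OF prv_St_closed, rotated 2]) auto
    then show "?L \<tturnstile> St (Var i)"
      by (rule prv_St_eq[OF _ prv_sym[OF eq]])
  qed simp
  then have "{} \<tturnstile> \<^bold>\<forall>\<^sup>s\<^sup>tn. (?\<phi> \<^bold>\<longrightarrow> subst n (suc (Var n)) ?\<phi>)"
    by (auto intro!: prv_allI prv_impI)
  moreover have "{} \<tturnstile> subst n zero ?\<phi> \<^bold>\<and> (\<^bold>\<forall>\<^sup>s\<^sup>tn. (?\<phi> \<^bold>\<longrightarrow> subst n (suc (Var n)) ?\<phi>)) \<^bold>\<longrightarrow>
      (\<^bold>\<forall>\<^sup>s\<^sup>tn. ?\<phi>)"
    by (rule prv_ax, unfold P_sys_def, intro UnI1 UnI2 IAst.intros) auto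
  ultimately have "{} \<tturnstile> \<^bold>\<forall>\<^sup>s\<^sup>tn. ?\<phi>"
    by (rule prv_impE[OF _ prv_conjI[OF base], rotated])
  then have "H \<tturnstile> subst n u (St (Var n) \<^bold>\<longrightarrow> ?\<phi>)"
    by (intro prv_allE[OF prv_weaken]) (auto simp: assms)
  then have "H \<tturnstile> St u \<^bold>\<longrightarrow> (\<^bold>\<forall>i. (monus (suc (Var i)) u \<^bold>= zero \<^bold>\<longrightarrow> St (Var i)))"
    by simp
  then have "H \<tturnstile> \<^bold>\<forall>i. (monus (suc (Var i)) u \<^bold>= zero \<^bold>\<longrightarrow> St (Var i))"
    using assms(2) by (rule prv_impE)
  then have "H \<tturnstile> subst i t (monus (suc (Var i)) u \<^bold>= zero \<^bold>\<longrightarrow> St (Var i))"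
    by (rule prv_allE) (auto simp: assms)
  then have "H \<tturnstile> t \<^bold>< u \<^bold>\<longrightarrow> St t"
    by (simp add: lt_def le_def)
  then show ?thesis
    using assms(1) by (rule prv_impE)
qed

lemma fv_mem [simp]: "fv (mem \<sigma> i t s) = fv_tm t \<union> fv_tm s - {i}"
  by (auto simp: mem_def lt_def le_def)

lemma internal_mem [simp]: "internal (mem \<sigma> i t s)"
  by (simp add: mem_def lt_def le_def)

text \<open>The length of a standard sequence is standard, hence so is every index below it, and
  projecting at a standard index gives a standard value.\<close>

lemma prv_St_mem:
  assumes "H \<tturnstile> mem \<sigma> i t s" "H \<tturnstile> St s"
    and "tyof t = Some \<sigma>" "tyof s = Some (Sq \<sigma>)" "snd i = N" "i \<notin> fv_tm t" "i \<notin> fv_tm s"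
  shows "H \<tturnstile> St t"
proof -
  let ?\<phi> = "Var i \<^bold>< len_tm \<sigma> \<bullet> s \<^bold>\<and> t \<^bold>= nth_tm \<sigma> \<bullet> s \<bullet> Var i"
  \<comment> \<open>The index \<open>i\<close> may be free in the given context, which would block
    eliminating the existential. The argument therefore runs under these two hypotheses alone and is
    transferred by modus ponens.\<close>
  let ?H = "{mem \<sigma> i t s, St s}"
  have "?H \<tturnstile> St t"
  proof (rule prv_exE[where x = i and \<phi> = ?\<phi>])
    show "?H \<tturnstile> \<^bold>\<exists>i. ?\<phi>"
      using prv_hyp[of "mem \<sigma> i t s" ?H] assms by (simp add: mem_def[symmetric])
    let ?K = "insert ?\<phi> ?H"
    have "?K \<tturnstile> ?\<phi>"
      by (rule prv_hyp) (auto simp: assms lt_def le_def)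
    note D = prv_conjD1[OF this] prv_conjD2[OF this]
    have s: "?K \<tturnstile> St s"
      by (rule prv_hyp) (auto simp: assms)
    have len: "?K \<tturnstile> St (len_tm \<sigma> \<bullet> s)"
      by (rule prv_St_app[OF prv_St_closed s]) (auto simp: assms)
    have i: "?K \<tturnstile> St (Var i)"
      by (rule prv_St_less[OF D(1) len]) (auto simp: assms)
    have "?K \<tturnstile> St (nth_tm \<sigma> \<bullet> s \<bullet> Var i)"
      by (rule prv_St_app[OF prv_St_app[OF prv_St_closed s] i]) (auto simp: assms)
    then show "?K \<tturnstile> St t"
      using prv_sym[OF D(2)] by (rule prv_St_eq)
  qed (use assms in auto)
  then have "{} \<tturnstile> mem \<sigma> i t s \<^bold>\<longrightarrow> St s \<^bold>\<longrightarrow> St t"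
    by (intro prv_impI) (auto simp: assms insert_commute)
  then show ?thesis
    by (rule prv_impE[OF prv_impE[OF prv_weaken assms(1)] assms(2)])
qed


section \<open>The equivalence\<close>

text \<open>With the bound variables of the two formulas fixed, almost all instantiations
  replace a variable by itself, so no capture can occur.\<close>

abbreviation (input) vPsi :: var where "vPsi \<equiv> (''Psi'', type2 \<^bold>\<Rightarrow> Sq type1)"
abbreviation (input) vW :: var where "vW \<equiv> (''W'', Sq type2)"
abbreviation (input) vY :: var where "vY \<equiv> (''Y'', type2)"
abbreviation (input) vZ :: var where "vZ \<equiv> (''Z'', type2)"
abbreviation (input) vf :: var where "vf \<equiv> (''f'', type1)"
abbreviation (input) vg :: var where "vg \<equiv> (''g'', type1)"
abbreviation (input) vi :: var where "vi \<equiv> (''i'', N)"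

definition agree_st :: fm where
  "agree_st = (\<^bold>\<forall>\<^sup>s\<^sup>tvg. Var vZ \<bullet> Var vg \<^bold>= Var vY \<bullet> Var vg)"

definition std_part :: fm where
  "std_part = (\<^bold>\<exists>\<^sup>s\<^sup>tvZ. (Var vZ \<^bold>\<le>\<^sub>2 \<^bold>1 \<^bold>\<and> agree_st))"

definition agree_Psi :: fm where
  "agree_Psi =
     (\<^bold>\<forall>vf. (mem type1 vi (Var vf) (Var vPsi \<bullet> Var vZ) \<^bold>\<longrightarrow> Var vZ \<bullet> Var vf \<^bold>= Var vY \<bullet> Var vf))"

definition cover :: fm where
  "cover =
     (\<^bold>\<forall>vY. (Var vY \<^bold>\<le>\<^sub>2 \<^bold>1 \<^bold>\<longrightarrow> (\<^bold>\<exists>vZ. (mem type2 vi (Var vZ) (Var vW) \<^bold>\<and> agree_Psi))))"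

lemma STP2_eq: "STP2 = (\<^bold>\<forall>vY. (Var vY \<^bold>\<le>\<^sub>2 \<^bold>1 \<^bold>\<longrightarrow> std_part))"
  by (simp add: STP2_def std_part_def agree_st_def Let_def)

lemma STP2_normal_form_eq: "STP2_normal_form = (\<^bold>\<forall>\<^sup>s\<^sup>tvPsi. \<^bold>\<exists>\<^sup>s\<^sup>tvW. cover)"
  by (simp add: STP2_normal_form_def cover_def agree_Psi_def Let_def)

lemma fv_le2_one [simp]: "fv (t \<^bold>\<le>\<^sub>2 \<^bold>1) = fv_tm t - {vf}"
  by (auto simp: le2_one_def le_def Let_def)

lemma internal_le2_one [simp]: "internal (t \<^bold>\<le>\<^sub>2 \<^bold>1)"
  by (simp add: le2_one_def le_def Let_def)

lemma wff_parts [simp]: "wff agree_st" "wff std_part" "wff agree_Psi" "wff cover"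
  by (simp_all add: agree_st_def std_part_def agree_Psi_def cover_def)

lemma fv_parts [simp]:
  "fv agree_st = {vZ, vY}" "fv std_part = {vY}" "fv agree_Psi = {vPsi, vZ, vY}" "fv cover = {vPsi, vW}"
  by (auto simp: agree_st_def std_part_def agree_Psi_def cover_def)

lemma fv_closed [simp]: "fv STP2 = {}" "fv STP2_normal_form = {}"
  by (auto simp: STP2_eq STP2_normal_form_eq)

text \<open>Bounding \<open>f\<close> by membership in a sequence, rather than by standardness,
  keeps this formula internal and thus open to idealization.\<close>

lemma internal_agree_Psi [simp]: "internal agree_Psi"
  by (simp add: agree_Psi_def)

section \<open>From \<open>STP2\<close> to the normal form\<close>

lemma prv_agree_Psi:
  assumes "H \<tturnstile> agree_st" "H \<tturnstile> St (Var vZ)" "H \<tturnstile> St (Var vPsi)"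
    and "\<forall>\<phi>\<in>H. vf \<notin> fv \<phi>"
  shows "H \<tturnstile> agree_Psi"
  unfolding agree_Psi_def
proof (intro prv_allI prv_impI)
  let ?m = "mem type1 vi (Var vf) (Var vPsi \<bullet> Var vZ)"
  let ?K = "insert ?m H"
  \<comment> \<open>The sequence \<Psi>(Z) is standard by closure under application, so its member
    \<open>f\<close> is standard and the agreement at standard arguments applies to it.\<close>
  have Psi: "?K \<tturnstile> St (Var vPsi \<bullet> Var vZ)"
    by (rule prv_mono[OF prv_St_app[OF assms(3,2)]]) auto
  have st: "?K \<tturnstile> St (Var vf)"
    by (rule prv_St_mem[OF prv_hyp Psi]) auto
  have "?K \<tturnstile> subst vg (Var vf) (St (Var vg) \<^bold>\<longrightarrow> Var vZ \<bullet> Var vg \<^bold>= Var vY \<bullet> Var vg)"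
    by (rule prv_allE[OF prv_mono[OF assms(1)[unfolded agree_st_def]]]) auto
  then have "?K \<tturnstile> St (Var vf) \<^bold>\<longrightarrow> Var vZ \<bullet> Var vf \<^bold>= Var vY \<bullet> Var vf"
    by simp
  then show "?K \<tturnstile> Var vZ \<bullet> Var vf \<^bold>= Var vY \<bullet> Var vf"
    using st by (rule prv_impE)
qed (use assms in auto)

text \<open>The bound on \<open>Y\<close> is moved inside the existential, so that every
  \<open>Y\<close> whatsoever gets a standard \<open>Z\<close>, the form that contradicts the
  conclusion of idealization.\<close>

lemma prv_std_witness: "{STP2, St (Var vPsi)} \<tturnstile> \<^bold>\<exists>\<^sup>s\<^sup>tvZ. (Var vY \<^bold>\<le>\<^sub>2 \<^bold>1 \<^bold>\<longrightarrow> agree_Psi)"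
    (is "?H \<tturnstile> ?ex")
proof (rule prv_cases[of "Var vY \<^bold>\<le>\<^sub>2 \<^bold>1"])
  let ?K = "insert (Var vY \<^bold>\<le>\<^sub>2 \<^bold>1) ?H"
  have "?K \<tturnstile> Var vY \<^bold>\<le>\<^sub>2 \<^bold>1 \<^bold>\<longrightarrow> std_part"
    by (rule prv_spec[of _ vY], rule prv_hyp) (auto simp: STP2_eq)
  then have "?K \<tturnstile> std_part"
    by (rule prv_impE) (auto intro!: prv_hyp)
  then show "?K \<tturnstile> ?ex"
    unfolding std_part_def
  proof (rule prv_exE)
    let ?h = "St (Var vZ) \<^bold>\<and> Var vZ \<^bold>\<le>\<^sub>2 \<^bold>1 \<^bold>\<and> agree_st"
    let ?L = "insert ?h ?K"
    have h: "?L \<tturnstile> ?h"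
      by (rule prv_hyp) auto
    have "?L \<tturnstile> agree_Psi"
      by (rule prv_agree_Psi[OF prv_conjD2[OF prv_conjD2[OF h]] prv_conjD1[OF h] prv_hyp]) auto
    then have "?L \<tturnstile> Var vY \<^bold>\<le>\<^sub>2 \<^bold>1 \<^bold>\<longrightarrow> agree_Psi"
      by (intro prv_impI) (auto intro: prv_mono)
    then show "?L \<tturnstile> ?ex"
      by (rule prv_exI_same[OF prv_conjI[OF prv_conjD1[OF h]]])
  qed auto
next
  let ?K = "insert (\<^bold>\<not> Var vY \<^bold>\<le>\<^sub>2 \<^bold>1) ?H"
  \<comment> \<open>When the bound on \<open>Y\<close> fails, any standard \<open>Z\<close> will do;
    the default term is closed and hence standard.\<close>
  have "?K \<tturnstile> \<^bold>\<exists>vZ. St (Var vZ)"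
    by (rule prv_exI[of _ _ "default_tm type2"]) (auto intro: prv_St_closed simp del: default_tm.simps)
  then show "?K \<tturnstile> ?ex"
  proof (rule prv_exE)
    let ?L = "insert (St (Var vZ)) ?K"
    have "insert (Var vY \<^bold>\<le>\<^sub>2 \<^bold>1) ?L \<tturnstile> \<^bold>\<bottom>"
      by (rule prv_absurd[OF _ prv_hyp]) auto
    then have "insert (Var vY \<^bold>\<le>\<^sub>2 \<^bold>1) ?L \<tturnstile> agree_Psi"
      by (rule prv_botE) simp
    then have "?L \<tturnstile> Var vY \<^bold>\<le>\<^sub>2 \<^bold>1 \<^bold>\<longrightarrow> agree_Psi"
      by (rule prv_impI) simp
    then show "?L \<tturnstile> ?ex"
      by (intro prv_exI_same prv_conjI[OF prv_hyp]) auto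
  qed auto
qed simp

text \<open>If no standard \<open>W\<close> is a cover, each standard \<open>W\<close> has some
  \<open>Y\<close> that defeats all its members. Idealization then gives one \<open>Y\<close>
  defeating every standard \<open>Z\<close>, against \<open>prv_std_witness\<close>.\<close>

lemma prv_normal_form_of_STP2: "{STP2} \<tturnstile> STP2_normal_form"
  unfolding STP2_normal_form_eq
proof (rule prv_allI, rule prv_impI)
  let ?\<theta> = "Var vY \<^bold>\<le>\<^sub>2 \<^bold>1 \<^bold>\<longrightarrow> agree_Psi"
  let ?m = "mem type2 vi (Var vZ) (Var vW)"
  let ?fin = "\<^bold>\<forall>\<^sup>s\<^sup>tvW. \<^bold>\<exists>vY. \<^bold>\<forall>vZ. (?m \<^bold>\<longrightarrow> \<^bold>\<not> ?\<theta>)"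
  let ?all = "\<^bold>\<forall>\<^sup>s\<^sup>tvZ. \<^bold>\<not> ?\<theta>"
  let ?H = "{St (Var vPsi), STP2}"
  let ?goal = "\<^bold>\<exists>\<^sup>s\<^sup>tvW. cover"
  have no_all: "insert ?all ?H \<tturnstile> \<^bold>\<bottom>"
  proof (rule prv_exE[OF prv_mono[OF prv_std_witness]])
    let ?h = "St (Var vZ) \<^bold>\<and> ?\<theta>"
    let ?L = "insert ?h (insert ?all ?H)"
    have h: "?L \<tturnstile> ?h"
      by (rule prv_hyp) auto
    have "?L \<tturnstile> St (Var vZ) \<^bold>\<longrightarrow> \<^bold>\<not> ?\<theta>"
      by (rule prv_spec[of _ vZ], rule prv_hyp) auto
    from prv_impE[OF prv_impE[OF this prv_conjD1[OF h]] prv_conjD2[OF h]]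
    show "?L \<tturnstile> \<^bold>\<bottom>" .
  qed auto
  have no_ex: "insert (\<^bold>\<exists>vY. ?all) ?H \<tturnstile> \<^bold>\<bottom>"
    by (rule prv_exE[OF prv_hyp prv_mono[OF no_all]]) auto

  \<comment> \<open>The instance for the internal formula \<open>\<not> ?\<theta>\<close>, with the
    sequence \<open>W\<close> in the premise, \<open>Y\<close> as the ideal element and \<Psi> as a
    parameter.\<close>
  have ideal: "L \<tturnstile> ?fin \<^bold>\<longrightarrow> (\<^bold>\<exists>vY. ?all)" for L
    by (rule prv_ax, unfold P_sys_def, intro UnI1 UnI2 Ideal.intros) auto

  \<comment> \<open>Nested assumptions for deriving \<open>?fin\<close> by contradiction.
    \<open>?noY\<close> denies the existential over \<open>Y\<close> in \<open>?fin\<close>,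
    \<open>?noZ\<close> the one over \<open>Z\<close> in \<open>cover\<close>. Under
    \<open>?noY\<close> the sequence \<open>W\<close> is a cover, which the negated goal
    excludes.\<close>
  let ?K = "insert (\<^bold>\<not> ?goal) ?H"
  let ?noY = "\<^bold>\<forall>vY. \<^bold>\<not> (\<^bold>\<forall>vZ. (?m \<^bold>\<longrightarrow> \<^bold>\<not> ?\<theta>))"
  let ?K2 = "insert ?noY (insert (St (Var vW)) ?K)"
  let ?noZ = "\<^bold>\<forall>vZ. \<^bold>\<not> (?m \<^bold>\<and> agree_Psi)"
  let ?K3 = "insert ?noZ (insert (Var vY \<^bold>\<le>\<^sub>2 \<^bold>1) ?K2)"
  let ?K4 = "insert ?\<theta> (insert ?m ?K3)"
  have "?K4 \<tturnstile> agree_Psi"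
    by (rule prv_impE[of _ "Var vY \<^bold>\<le>\<^sub>2 \<^bold>1"]; rule prv_hyp) auto
  then have "?K4 \<tturnstile> ?m \<^bold>\<and> agree_Psi"
    by (intro prv_conjI[OF prv_hyp]) auto
  moreover have "?K4 \<tturnstile> \<^bold>\<not> (?m \<^bold>\<and> agree_Psi)"
    by (rule prv_spec[of _ vZ], rule prv_hyp) auto
  ultimately have "?K4 \<tturnstile> \<^bold>\<bottom>"
    by (rule prv_impE[rotated])
  then have allZ: "?K3 \<tturnstile> \<^bold>\<forall>vZ. (?m \<^bold>\<longrightarrow> \<^bold>\<not> ?\<theta>)"
    by (intro prv_allI prv_impI) auto
  have "?K3 \<tturnstile> \<^bold>\<not> (\<^bold>\<forall>vZ. (?m \<^bold>\<longrightarrow> \<^bold>\<not> ?\<theta>))"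
    by (rule prv_spec[of _ vY], rule prv_hyp) auto
  then have "?K3 \<tturnstile> \<^bold>\<bottom>"
    using allZ by (rule prv_impE)
  then have "?K2 \<tturnstile> cover"
    unfolding cover_def by (intro prv_allI prv_impI) auto
  then have "?K2 \<tturnstile> ?goal"
    by (intro prv_exI_same prv_conjI[OF prv_hyp]) auto
  then have "?K2 \<tturnstile> \<^bold>\<bottom>"
    by (rule prv_absurd[rotated]) auto
  then have "?K \<tturnstile> ?fin"
    by (intro prv_allI prv_impI) auto
  then have "?K \<tturnstile> \<^bold>\<exists>vY. ?all"
    by (rule prv_impE[OF ideal])
  moreover have "?K \<tturnstile> (\<^bold>\<exists>vY. ?all) \<^bold>\<longrightarrow> \<^bold>\<bottom>"
    by (rule prv_mono[OF prv_impI[OF no_ex]]) auto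
  ultimately have "?K \<tturnstile> \<^bold>\<bottom>"
    by (rule prv_impE[rotated])
  then show "?H \<tturnstile> ?goal"
    by (rule prv_raa) auto
qed auto

section \<open>From the normal form to \<open>STP2\<close>\<close>

abbreviation (input) sgZ :: tm where "sgZ \<equiv> comp_tm type1 N N sg_tm (Var vZ)"

lemma prv_sgZ_le2_one: "H \<tturnstile> sgZ \<^bold>\<le>\<^sub>2 \<^bold>1"
proof -
  have "{} \<tturnstile> sgZ \<bullet> Var vf \<^bold>= sg_tm \<bullet> (Var vZ \<bullet> Var vf)"
    by (rule prv_comp) auto
  then have "{} \<tturnstile> monus (sgZ \<bullet> Var vf) (suc zero) \<^bold>= monus (sg_tm \<bullet> (Var vZ \<bullet> Var vf)) (suc zero)"
    by (rule prv_monus_cong) auto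
  from prv_trans[OF this prv_sg_le_one[unfolded le_def]]
  have "{} \<tturnstile> sgZ \<bullet> Var vf \<^bold>\<le> suc zero"
    by (simp add: le_def)
  then have "{} \<tturnstile> sgZ \<^bold>\<le>\<^sub>2 \<^bold>1"
    unfolding le2_one_def Let_def by (rule prv_allI) simp
  then show ?thesis
    by (rule prv_weaken)
qed

text \<open>Truncation leaves the values of \<open>Y\<close> unchanged, so applying
  \<open>sg_tm\<close> to both sides carries the agreement over to the truncated
  \<open>Z\<close>.\<close>

lemma prv_sgZ_eq:
  assumes "H \<tturnstile> Var vY \<^bold>\<le>\<^sub>2 \<^bold>1" "H \<tturnstile> Var vZ \<bullet> Var vf \<^bold>= Var vY \<bullet> Var vf"
  shows "H \<tturnstile> sgZ \<bullet> Var vf \<^bold>= Var vY \<bullet> Var vf"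
proof -
  have "H \<tturnstile> Var vY \<bullet> Var vf \<^bold>\<le> suc zero"
    using assms(1) unfolding le2_one_def Let_def by (rule prv_spec)
  then have "H \<tturnstile> sg_tm \<bullet> (Var vY \<bullet> Var vf) \<^bold>= Var vY \<bullet> Var vf"
    by (rule prv_sg_fixed) simp
  moreover have "H \<tturnstile> sg_tm \<bullet> (Var vZ \<bullet> Var vf) \<^bold>= sg_tm \<bullet> (Var vY \<bullet> Var vf)"
    by (rule prv_cong_arg[OF assms(2)]) auto
  ultimately have "H \<tturnstile> sg_tm \<bullet> (Var vZ \<bullet> Var vf) \<^bold>= Var vY \<bullet> Var vf"
    by (rule prv_trans[rotated])
  then show ?thesis
    by (rule prv_trans[OF prv_comp, rotated 3]) auto
qed

text \<open>The clash occurs at a single \<open>Z\<close> in the cover \<open>W\<close>: it agrees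
  with \<open>Y\<close> on all of \<Psi>(Z), hence so does its truncation, yet \<Psi> was chosen so
  that the truncation differs from \<open>Y\<close> somewhere on \<Psi>(Z).\<close>

lemma prv_STP2_of_normal_form: "{STP2_normal_form} \<tturnstile> STP2"
  unfolding STP2_eq
proof (intro prv_allI prv_impI)
  let ?H = "{Var vY \<^bold>\<le>\<^sub>2 \<^bold>1, STP2_normal_form}"
  let ?\<phi> = "\<^bold>\<not> sgZ \<bullet> Var vf \<^bold>= Var vY \<bullet> Var vf"
  let ?m = "mem type1 vi (Var vf) (Var vPsi \<bullet> Var vZ)"
  let ?ch = "\<^bold>\<forall>\<^sup>s\<^sup>tvZ. \<^bold>\<exists>vf. (?m \<^bold>\<and> ?\<phi>)"
  let ?K = "insert (\<^bold>\<not> std_part) ?H"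
  let ?noF = "\<^bold>\<forall>vf. \<^bold>\<not> (St (Var vf) \<^bold>\<and> ?\<phi>)"
  let ?K1 = "insert ?noF (insert (St (Var vZ)) ?K)"
  let ?K2 = "insert (\<^bold>\<not> sgZ \<bullet> Var vg \<^bold>= Var vY \<bullet> Var vg) (insert (St (Var vg)) ?K1)"
  \<comment> \<open>If no standard \<open>f\<close> separated the truncated \<open>Z\<close> from
    \<open>Y\<close>, the two would agree at every standard \<open>g\<close>, which makes the
    truncation a standard part of \<open>Y\<close>.\<close>
  have "?K2 \<tturnstile> subst vf (Var vg) (\<^bold>\<not> (St (Var vf) \<^bold>\<and> ?\<phi>))"
    by (rule prv_allE[OF prv_hyp]) auto
  then have "?K2 \<tturnstile> \<^bold>\<not> (St (Var vg) \<^bold>\<and> \<^bold>\<not> sgZ \<bullet> Var vg \<^bold>= Var vY \<bullet> Var vg)"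
    by simp
  then have "?K2 \<tturnstile> \<^bold>\<bottom>"
    by (rule prv_impE) (intro prv_conjI prv_hyp; auto)
  then have "insert (St (Var vg)) ?K1 \<tturnstile> sgZ \<bullet> Var vg \<^bold>= Var vY \<bullet> Var vg"
    by (rule prv_raa) auto
  then have agree: "?K1 \<tturnstile> \<^bold>\<forall>\<^sup>s\<^sup>tvg. sgZ \<bullet> Var vg \<^bold>= Var vY \<bullet> Var vg"
    by (intro prv_allI prv_impI) auto
  \<comment> \<open>Unfolded, the composition is a closed term applied to \<open>Z\<close>, and so
    is standard along with \<open>Z\<close>.\<close>
  have "?K1 \<tturnstile> St (Con (Sig type1 N N) \<bullet> (Con (Pi (N \<^bold>\<Rightarrow> N) type1) \<bullet> sg_tm) \<bullet> Var vZ)"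
    by (rule prv_St_app[OF prv_St_closed prv_hyp]) auto
  then have "?K1 \<tturnstile> St sgZ"
    by (simp add: comp_tm_def)
  from prv_conjI[OF this prv_conjI[OF prv_sgZ_le2_one agree]]
  have "?K1 \<tturnstile> subst vZ sgZ (St (Var vZ) \<^bold>\<and> Var vZ \<^bold>\<le>\<^sub>2 \<^bold>1 \<^bold>\<and> agree_st)"
    by (simp add: agree_st_def le2_one_def le_def Let_def)
  then have "?K1 \<tturnstile> std_part"
    unfolding std_part_def by (rule prv_exI) (auto simp: agree_st_def le2_one_def le_def Let_def)
  then have "?K1 \<tturnstile> \<^bold>\<bottom>"
    by (rule prv_absurd[rotated]) auto
  then have "?K \<tturnstile> \<^bold>\<forall>\<^sup>s\<^sup>tvZ. \<^bold>\<exists>\<^sup>s\<^sup>tvf. ?\<phi>"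
    by (intro prv_allI prv_impI) auto
  \<comment> \<open>Choice with \<open>Z\<close> as argument, \<open>f\<close> as value and \<Psi>
    as choice functional. The formula is internal, with \<open>Y\<close> as a parameter that need
    not be standard.\<close>
  moreover have "?K \<tturnstile> (\<^bold>\<forall>\<^sup>s\<^sup>tvZ. \<^bold>\<exists>\<^sup>s\<^sup>tvf. ?\<phi>) \<^bold>\<longrightarrow> (\<^bold>\<exists>\<^sup>s\<^sup>tvPsi. ?ch)"
    by (rule prv_ax, unfold P_sys_def, intro UnI2 HACint.intros) auto
  ultimately have "?K \<tturnstile> \<^bold>\<exists>\<^sup>s\<^sup>tvPsi. ?ch"
    by (rule prv_impE[rotated])
  then have "?K \<tturnstile> \<^bold>\<bottom>"
  proof (rule prv_exE)
    let ?hPsi = "St (Var vPsi) \<^bold>\<and> ?ch"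
    let ?L1 = "insert ?hPsi ?K"
    let ?hW = "St (Var vW) \<^bold>\<and> cover"
    let ?L2 = "insert ?hW ?L1"
    let ?hZ = "mem type2 vi (Var vZ) (Var vW) \<^bold>\<and> agree_Psi"
    let ?L3 = "insert ?hZ ?L2"
    let ?hf = "?m \<^bold>\<and> ?\<phi>"
    let ?L4 = "insert ?hf ?L3"
    have hPsi: "L \<tturnstile> ?hPsi" if "?hPsi \<in> L" for L
      by (rule prv_hyp[OF that]) auto
    have "?L1 \<tturnstile> St (Var vPsi) \<^bold>\<longrightarrow> (\<^bold>\<exists>\<^sup>s\<^sup>tvW. cover)"
      by (rule prv_spec[of _ vPsi], rule prv_hyp) (auto simp: STP2_normal_form_eq)
    then have "?L1 \<tturnstile> \<^bold>\<exists>\<^sup>s\<^sup>tvW. cover"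
      by (rule prv_impE) (rule prv_conjD1[OF hPsi]; simp)
    then show "?L1 \<tturnstile> \<^bold>\<bottom>"
    proof (rule prv_exE)
      have hW: "L \<tturnstile> ?hW" if "?hW \<in> L" for L
        by (rule prv_hyp[OF that]) auto
      have "?L2 \<tturnstile> Var vY \<^bold>\<le>\<^sub>2 \<^bold>1 \<^bold>\<longrightarrow> (\<^bold>\<exists>vZ. ?hZ)"
        by (rule prv_spec[of _ vY], fold cover_def, rule prv_conjD2[OF hW]) simp
      then have "?L2 \<tturnstile> \<^bold>\<exists>vZ. ?hZ"
        by (rule prv_impE) (rule prv_hyp; auto)
      then show "?L2 \<tturnstile> \<^bold>\<bottom>"
      proof (rule prv_exE)
        have hZ: "L \<tturnstile> ?hZ" if "?hZ \<in> L" for L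
          by (rule prv_hyp[OF that]) auto
        \<comment> \<open>The choice property speaks of standard arguments only; this
          \<open>Z\<close> qualifies as a member of the standard sequence \<open>W\<close>.\<close>
        have "?L3 \<tturnstile> St (Var vZ)"
          by (rule prv_St_mem[OF prv_conjD1[OF hZ] prv_conjD1[OF hW]]) auto
        moreover have "?L3 \<tturnstile> St (Var vZ) \<^bold>\<longrightarrow> (\<^bold>\<exists>vf. ?hf)"
          by (rule prv_spec[of _ vZ], rule prv_conjD2[OF hPsi]) simp
        ultimately have "?L3 \<tturnstile> \<^bold>\<exists>vf. ?hf"
          by (rule prv_impE[rotated])
        then show "?L3 \<tturnstile> \<^bold>\<bottom>"
        proof (rule prv_exE)
          have hf: "?L4 \<tturnstile> ?hf"
            by (rule prv_hyp) auto
          have "?L4 \<tturnstile> ?m \<^bold>\<longrightarrow> Var vZ \<bullet> Var vf \<^bold>= Var vY \<bullet> Var vf"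
            by (rule prv_spec[of _ vf], fold agree_Psi_def, rule prv_conjD2[OF hZ]) simp
          then have eq: "?L4 \<tturnstile> Var vZ \<bullet> Var vf \<^bold>= Var vY \<bullet> Var vf"
            using prv_conjD1[OF hf] by (rule prv_impE)
          have "?L4 \<tturnstile> sgZ \<bullet> Var vf \<^bold>= Var vY \<bullet> Var vf"
            by (rule prv_sgZ_eq[OF prv_hyp eq]) auto
          then show "?L4 \<tturnstile> \<^bold>\<bottom>"
            by (rule prv_impE[OF prv_conjD2[OF hf]])
        qed auto
      qed auto
    qed auto
  qed auto
  then show "?H \<tturnstile> std_part"
    by (rule prv_raa) auto
qed auto

theorem theorem4p11:
  shows "P_sys; {} \<turnstile> STP2 \<^bold>\<longleftrightarrow> STP2_normal_form"
  unfolding prv_empty[symmetric]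
  by (intro prv_conjI prv_impI prv_normal_form_of_STP2 prv_STP2_of_normal_form
      wff_STP2 wff_STP2_normal_form)

end
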